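(* Let $\bar G$ be a finite group, let $A=\bigoplus_{\bar g\in\bar G}A_{\bar g}$ be a $\bar G$-graded crossed product over $\mathcal{O}$ with identity component $B=A_1$, and let $U$ be a $B$-module. Let $C_A(B)$ be the centralizer of $B$ in $A$ and let $E(U)=\mathrm{End}_A(A\otimes_BU)^{\mathrm{op}}$. Then the map $$\theta:C_A(B)\to E(U),\qquad \theta(c)(a\otimes u)=ac\otimes u,$$ where $c\in C_A(B)$, $a\in A$ and $u\in U$, is a (well-defined) homomorphism of $\bar G$-graded algebras.
   Context: $(\mathcal{K},\mathcal{O},k)$ is a $p$-modular system; algebras are $\mathcal{O}$-algebras. A $\bar G$-graded crossed product is a $\bar G$-graded algebra $A$ such that each component $A_{\bar g}$ contains an invertible element of $A$. The centralizer $C_A(B)$ is $\bar G$-graded with components $C_A(B)_{\bar h}=C_A(B)\cap A_{\bar h}$. The algebra $E(U)$ is $\bar G$-graded with $E(U)_{\bar h}=\{f\in E(U)\mid f(A_{\bar g}\otimes_BU)\subseteq A_{\bar g\bar h}\otimes_BU\text{ for all }\bar g\in\bar G\}$; its multiplication is opposite to composition, i.e. $f\cdot f'=f'\circ f$. *)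

theory Defs
  imports "HOL-Algebra.Algebra"
begin

section \<open>$p$-modular systems\<close>

definition has_char :: "('a, 'm) ring_scheme \<Rightarrow> nat \<Rightarrow> bool" where
  "has_char R n \<longleftrightarrow> (\<forall>m::nat. add_pow R m \<one>\<^bsub>R\<^esub> = \<zero>\<^bsub>R\<^esub> \<longleftrightarrow> n dvd m)"

locale discrete_valuation_ring = principal_domain R for R (structure) +
  assumes not_field: "\<not> field R"
    and unique_maximal: "\<exists>!P. maximalideal P R"

text \<open>Only meaningful for a local ring.\<close>
definition max_ideal :: "('a, 'm) ring_scheme \<Rightarrow> 'a set" where
  "max_ideal R = (THE P. maximalideal P R)"

abbreviation max_ideal_pow :: "('a, 'm) ring_scheme \<Rightarrow> nat \<Rightarrow> 'a set" where
  "max_ideal_pow R n \<equiv> max_ideal R [^]\<^bsub>ideals_set R\<^esub> n"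

definition adic_Cauchy :: "('a, 'm) ring_scheme \<Rightarrow> (nat \<Rightarrow> 'a) \<Rightarrow> bool" where
  "adic_Cauchy R x \<longleftrightarrow>
     (\<forall>n. \<exists>N. \<forall>i\<ge>N. \<forall>j\<ge>N. x i \<ominus>\<^bsub>R\<^esub> x j \<in> max_ideal_pow R n)"

definition adic_limit :: "('a, 'm) ring_scheme \<Rightarrow> (nat \<Rightarrow> 'a) \<Rightarrow> 'a \<Rightarrow> bool" where
  "adic_limit R x l \<longleftrightarrow> (\<forall>n. \<exists>N. \<forall>i\<ge>N. x i \<ominus>\<^bsub>R\<^esub> l \<in> max_ideal_pow R n)"

text \<open>Separatedness of the adic topology is automatic for a discrete valuation ring.\<close>
locale complete_discrete_valuation_ring = discrete_valuation_ring +
  assumes complete: "x \<in> UNIV \<rightarrow> carrier R \<Longrightarrow> adic_Cauchy R x \<Longrightarrow>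
    \<exists>l\<in>carrier R. adic_limit R x l"

definition is_field_of_fractions ::
    "('k, 'm) ring_scheme \<Rightarrow> ('o, 'n) ring_scheme \<Rightarrow> bool" where
  "is_field_of_fractions K R \<longleftrightarrow> field K \<and>
     (\<exists>\<iota>\<in>ring_hom R K. inj_on \<iota> (carrier R) \<and>
        (\<forall>x\<in>carrier K. \<exists>a\<in>carrier R. \<exists>b\<in>carrier R - {\<zero>\<^bsub>R\<^esub>}.
           x = \<iota> a \<otimes>\<^bsub>K\<^esub> inv\<^bsub>K\<^esub> \<iota> b))"

locale p_modular_system =
  fixes p :: nat
    and K :: "('k, 'm1) ring_scheme"
    and R :: "('o, 'm2) ring_scheme"
    and k :: "('l, 'm3) ring_scheme"
  assumes prime_p: "Factorial_Ring.prime p"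
    and valuation_ring: "complete_discrete_valuation_ring R"
    and fraction_field: "is_field_of_fractions K R"
    and residue_field: "field k" "R Quot (max_ideal R) \<simeq> k"
    and char_K: "has_char K 0"
    and char_k: "has_char k p"


section \<open>Algebras, graded algebras, crossed products\<close>

text \<open>The library locale \<^locale>\<open>algebra\<close> requires the algebra to be commutative, and
  \<^locale>\<open>module\<close> requires the ring of scalars to be commutative.\<close>

locale assoc_algebra = module R A + ring A
  for R :: "('o, 'm) ring_scheme" and A :: "('o, 'a, 'n) module_scheme" +
  assumes smult_mult_left: "\<lbrakk>r \<in> carrier R; x \<in> carrier A; y \<in> carrier A\<rbrakk> \<Longrightarrow>
      (r \<odot>\<^bsub>A\<^esub> x) \<otimes>\<^bsub>A\<^esub> y = r \<odot>\<^bsub>A\<^esub> (x \<otimes>\<^bsub>A\<^esub> y)"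
    and smult_mult_right: "\<lbrakk>r \<in> carrier R; x \<in> carrier A; y \<in> carrier A\<rbrakk> \<Longrightarrow>
      x \<otimes>\<^bsub>A\<^esub> (r \<odot>\<^bsub>A\<^esub> y) = r \<odot>\<^bsub>A\<^esub> (x \<otimes>\<^bsub>A\<^esub> y)"

locale left_module = R?: ring R + M?: abelian_group M
  for R :: "('b, 'm) ring_scheme" and M :: "('b, 'u, 'n) module_scheme" +
  assumes smult_closed: "\<lbrakk>a \<in> carrier R; x \<in> carrier M\<rbrakk> \<Longrightarrow> a \<odot>\<^bsub>M\<^esub> x \<in> carrier M"
    and smult_l_distr: "\<lbrakk>a \<in> carrier R; b \<in> carrier R; x \<in> carrier M\<rbrakk> \<Longrightarrow>
      (a \<oplus>\<^bsub>R\<^esub> b) \<odot>\<^bsub>M\<^esub> x = a \<odot>\<^bsub>M\<^esub> x \<oplus>\<^bsub>M\<^esub> b \<odot>\<^bsub>M\<^esub> x"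
    and smult_r_distr: "\<lbrakk>a \<in> carrier R; x \<in> carrier M; y \<in> carrier M\<rbrakk> \<Longrightarrow>
      a \<odot>\<^bsub>M\<^esub> (x \<oplus>\<^bsub>M\<^esub> y) = a \<odot>\<^bsub>M\<^esub> x \<oplus>\<^bsub>M\<^esub> a \<odot>\<^bsub>M\<^esub> y"
    and smult_assoc: "\<lbrakk>a \<in> carrier R; b \<in> carrier R; x \<in> carrier M\<rbrakk> \<Longrightarrow>
      (a \<otimes>\<^bsub>R\<^esub> b) \<odot>\<^bsub>M\<^esub> x = a \<odot>\<^bsub>M\<^esub> (b \<odot>\<^bsub>M\<^esub> x)"
    and smult_one: "x \<in> carrier M \<Longrightarrow> \<one>\<^bsub>R\<^esub> \<odot>\<^bsub>M\<^esub> x = x"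

locale graded_algebra = assoc_algebra R A + G: group G
  for R :: "('o, 'm) ring_scheme" and G :: "('g, 'q) monoid_scheme"
    and A :: "('o, 'a, 'n) module_scheme" and gr :: "'g \<Rightarrow> 'a set" +
  assumes finite_G: "finite (carrier G)"
    and comp_submodule: "g \<in> carrier G \<Longrightarrow> submodule (gr g) R A"
    and comp_mult: "\<lbrakk>g \<in> carrier G; h \<in> carrier G; x \<in> gr g; y \<in> gr h\<rbrakk> \<Longrightarrow>
      x \<otimes>\<^bsub>A\<^esub> y \<in> gr (g \<otimes>\<^bsub>G\<^esub> h)"
    and direct_sum: "a \<in> carrier A \<Longrightarrow>
      \<exists>!x. x \<in> (\<Pi>\<^sub>E g\<in>carrier G. gr g) \<and> a = (\<Oplus>\<^bsub>A\<^esub>g\<in>carrier G. x g)"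

locale crossed_product = graded_algebra +
  assumes unit_in_comp: "g \<in> carrier G \<Longrightarrow> gr g \<inter> Units A \<noteq> {}"

locale graded_algebra_hom = dom: graded_algebra R G A gr + cod: graded_algebra R G A' gr'
  for R :: "('o, 'm) ring_scheme" and G :: "('g, 'q) monoid_scheme"
    and A :: "('o, 'a, 'n) module_scheme" and gr :: "'g \<Rightarrow> 'a set"
    and A' :: "('o, 'b, 'n') module_scheme" and gr' :: "'g \<Rightarrow> 'b set" +
  fixes \<phi> :: "'a \<Rightarrow> 'b"
  assumes ring_hom: "\<phi> \<in> ring_hom A A'"
    and linear: "\<lbrakk>r \<in> carrier R; x \<in> carrier A\<rbrakk> \<Longrightarrow> \<phi> (r \<odot>\<^bsub>A\<^esub> x) = r \<odot>\<^bsub>A'\<^esub> \<phi> x"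
    and graded: "g \<in> carrier G \<Longrightarrow> \<phi> ` gr g \<subseteq> gr' g"

definition subalg :: "('o, 'a, 'n) module_scheme \<Rightarrow> 'a set \<Rightarrow> ('o, 'a, 'n) module_scheme" where
  "subalg A S = A\<lparr>carrier := S\<rparr>"

definition centralizer :: "('a, 'n) ring_scheme \<Rightarrow> 'a set \<Rightarrow> 'a set" where
  "centralizer A B = {c \<in> carrier A. \<forall>b\<in>B. b \<otimes>\<^bsub>A\<^esub> c = c \<otimes>\<^bsub>A\<^esub> b}"


section \<open>The induced module\<close>

text \<open>Here \<open>B\<close> is (the carrier of) a subring of \<open>A\<close>, so that \<open>A\<close> is an
  \<open>(A, B)\<close>-bimodule, and \<open>U\<close> is a left \<open>B\<close>-module. The tensor product
  of \<open>A\<close> and \<open>U\<close> over \<open>B\<close> is the free abelian group on pairs modulo the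
  subgroup generated by the following elements.\<close>

definition tensor_relators ::
    "('o, 'a, 'n) module_scheme \<Rightarrow> 'a set \<Rightarrow> ('a, 'u, 'm) module_scheme \<Rightarrow> ('a \<times> 'u \<Rightarrow>\<^sub>0 int) set"
  where
  "tensor_relators A B U =
     {frag_of (a \<oplus>\<^bsub>A\<^esub> a', u) - frag_of (a, u) - frag_of (a', u) | a a' u.
        a \<in> carrier A \<and> a' \<in> carrier A \<and> u \<in> carrier U} \<union>
     {frag_of (a, u \<oplus>\<^bsub>U\<^esub> u') - frag_of (a, u) - frag_of (a, u') | a u u'.
        a \<in> carrier A \<and> u \<in> carrier U \<and> u' \<in> carrier U} \<union>
     {frag_of (a \<otimes>\<^bsub>A\<^esub> b, u) - frag_of (a, b \<odot>\<^bsub>U\<^esub> u) | a b u.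
        a \<in> carrier A \<and> b \<in> B \<and> u \<in> carrier U}"

abbreviation tensor_free ::
    "('o, 'a, 'n) module_scheme \<Rightarrow> ('a, 'u, 'm) module_scheme \<Rightarrow> ('a \<times> 'u \<Rightarrow>\<^sub>0 int) monoid" where
  "tensor_free A U \<equiv> free_Abelian_group (carrier A \<times> carrier U)"

definition tensor_null ::
    "('o, 'a, 'n) module_scheme \<Rightarrow> 'a set \<Rightarrow> ('a, 'u, 'm) module_scheme \<Rightarrow> ('a \<times> 'u \<Rightarrow>\<^sub>0 int) set"
  where
  "tensor_null A B U = generate (tensor_free A U) (tensor_relators A B U)"

definition tensor_coset ::
    "('o, 'a, 'n) module_scheme \<Rightarrow> 'a set \<Rightarrow> ('a, 'u, 'm) module_scheme \<Rightarrow>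
     ('a \<times> 'u \<Rightarrow>\<^sub>0 int) \<Rightarrow> ('a \<times> 'u \<Rightarrow>\<^sub>0 int) set" where
  "tensor_coset A B U x = tensor_null A B U #>\<^bsub>tensor_free A U\<^esub> x"

definition pure_tensor ::
    "('o, 'a, 'n) module_scheme \<Rightarrow> 'a set \<Rightarrow> ('a, 'u, 'm) module_scheme \<Rightarrow>
     'a \<Rightarrow> 'u \<Rightarrow> ('a \<times> 'u \<Rightarrow>\<^sub>0 int) set" where
  "pure_tensor A B U a u = tensor_coset A B U (frag_of (a, u))"

text \<open>The action of \<open>A\<close> is induced by left multiplication on the first factor. The union below
  is over representatives of a coset; all its members coincide. The record fields for a ring
  multiplication and a one play no role in a module.\<close>

definition induced_module ::
    "('o, 'a, 'n) module_scheme \<Rightarrow> 'a set \<Rightarrow> ('a, 'u, 'm) module_scheme \<Rightarrow>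
     ('a, ('a \<times> 'u \<Rightarrow>\<^sub>0 int) set) module" where
  "induced_module A B U =
     (let Q = tensor_free A U Mod tensor_null A B U in
      \<lparr>carrier = carrier Q, monoid.mult = undefined, monoid.one = undefined,
       ring.zero = monoid.one Q, add = monoid.mult Q,
       smult = (\<lambda>a Z. \<Union>x\<in>Z. tensor_coset A B U
                         (frag_extend (\<lambda>(a', u). frag_of (a \<otimes>\<^bsub>A\<^esub> a', u)) x))\<rparr>)"

text \<open>For a right \<open>B\<close>-submodule \<open>D\<close> of \<open>A\<close>, the image in the induced module of the
  tensor product of \<open>D\<close> and \<open>U\<close>. For a homogeneous component \<open>D\<close> the map onto this image is
  injective, since \<open>D\<close> is a direct summand of \<open>A\<close> as a right \<open>B\<close>-module.\<close>

definition tensor_part ::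
    "('o, 'a, 'n) module_scheme \<Rightarrow> 'a set \<Rightarrow> ('a, 'u, 'm) module_scheme \<Rightarrow> 'a set \<Rightarrow>
     ('a \<times> 'u \<Rightarrow>\<^sub>0 int) set set" where
  "tensor_part A B U D =
     generate (add_monoid (induced_module A B U))
       {pure_tensor A B U d u | d u. d \<in> D \<and> u \<in> carrier U}"


section \<open>The opposite endomorphism algebra\<close>

definition module_endos ::
    "('a, 'n) ring_scheme \<Rightarrow> ('a, 't, 'm) module_scheme \<Rightarrow> ('t \<Rightarrow> 't) set" where
  "module_endos A T = {f \<in> carrier T \<rightarrow>\<^sub>E carrier T.
     (\<forall>x\<in>carrier T. \<forall>y\<in>carrier T. f (x \<oplus>\<^bsub>T\<^esub> y) = f x \<oplus>\<^bsub>T\<^esub> f y) \<and>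
     (\<forall>a\<in>carrier A. \<forall>x\<in>carrier T. f (a \<odot>\<^bsub>T\<^esub> x) = a \<odot>\<^bsub>T\<^esub> f x)}"

text \<open>The product of \<open>f\<close> and \<open>f'\<close> is \<open>f'\<close> after \<open>f\<close>. A scalar \<open>r\<close> of the ground ring acts on an
  \<open>A\<close>-module through its image in \<open>A\<close>.\<close>

definition op_endo_algebra ::
    "('o, 'a, 'n) module_scheme \<Rightarrow> ('a, 't, 'm) module_scheme \<Rightarrow> ('o, 't \<Rightarrow> 't) module" where
  "op_endo_algebra A T =
     \<lparr>carrier = module_endos A T,
      monoid.mult = (\<lambda>f f'. compose (carrier T) f' f),
      monoid.one = (\<lambda>x\<in>carrier T. x),
      ring.zero = (\<lambda>x\<in>carrier T. \<zero>\<^bsub>T\<^esub>),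
      add = (\<lambda>f f'. \<lambda>x\<in>carrier T. f x \<oplus>\<^bsub>T\<^esub> f' x),
      smult = (\<lambda>r f. \<lambda>x\<in>carrier T. (r \<odot>\<^bsub>A\<^esub> \<one>\<^bsub>A\<^esub>) \<odot>\<^bsub>T\<^esub> f x)\<rparr>"

definition E_alg ::
    "('o, 'a, 'n) module_scheme \<Rightarrow> 'a set \<Rightarrow> ('a, 'u, 'm) module_scheme \<Rightarrow>
     ('o, ('a \<times> 'u \<Rightarrow>\<^sub>0 int) set \<Rightarrow> ('a \<times> 'u \<Rightarrow>\<^sub>0 int) set) module" where
  "E_alg A B U = op_endo_algebra A (induced_module A B U)"

definition E_comp ::
    "('g, 'q) monoid_scheme \<Rightarrow> ('o, 'a, 'n) module_scheme \<Rightarrow> ('g \<Rightarrow> 'a set) \<Rightarrow>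
     ('a, 'u, 'm) module_scheme \<Rightarrow> 'g \<Rightarrow>
     (('a \<times> 'u \<Rightarrow>\<^sub>0 int) set \<Rightarrow> ('a \<times> 'u \<Rightarrow>\<^sub>0 int) set) set" where
  "E_comp G A gr U h =
     (let B = gr \<one>\<^bsub>G\<^esub> in
      {f \<in> carrier (E_alg A B U). \<forall>g\<in>carrier G.
         f ` tensor_part A B U (gr g) \<subseteq> tensor_part A B U (gr (g \<otimes>\<^bsub>G\<^esub> h))})"

end

theory Submission
  imports Defs
begin

text \<open>A right \<open>B\<close>-linear endomorphism \<open>\<phi>\<close> of \<open>A\<close> induces an endomorphism \<open>\<phi> \<otimes> id\<close> of
  \<open>A \<otimes>\<^sub>B U\<close>, and an additive map on \<open>A \<otimes>\<^sub>B U\<close> is determined by its values on pure tensors. Right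
  multiplication by \<open>c\<close> is right \<open>B\<close>-linear exactly because \<open>c\<close> centralizes \<open>B\<close>; this gives
  \<open>\<theta>(c)\<close>, and all identities for \<open>\<theta>\<close> are read off on pure tensors. The projections of \<open>A\<close> onto its
  components are right \<open>B\<close>-linear as well, so they grade \<open>A \<otimes>\<^sub>B U\<close> by projections \<open>P\<^sub>g\<close>, and an
  endomorphism \<open>f\<close> has the homogeneous components \<open>f\<^sub>h = \<Sum>\<^sub>g P\<^sub>g\<^sub>h f P\<^sub>g\<close>. The centralizer is graded
  since the projections of \<open>A\<close> commute with multiplication by elements of \<open>B\<close> on either side.\<close>

section \<open>Additive maps and internal direct sums\<close>

text \<open>A homomorphism of graded algebras presupposes that both sides are graded algebras, so
  most of the work goes into the decomposition of \<open>E(U)\<close> rather than into \<theta>. The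
  formula for \<open>f\<^sub>h\<close> is dictated by the side on which \<open>A\<close> acts: a
  homogeneous element of degree \<open>k\<close> translates degrees by \<open>k\<close> from the
  left, so an endomorphism of degree \<open>h\<close> has to translate them from the right. The sum
  over all \<open>g\<close> is invariant under replacing \<open>g\<close> by \<open>k g\<close>, and
  this makes \<open>f\<^sub>h\<close> linear over homogeneous elements. Finiteness of the group
  turns the sum over \<open>g\<close> and the sum of all \<open>f\<^sub>h\<close> into finite sums.
  The grading axioms do not mention the unit. That scalars of the ground ring preserve degrees in
  \<open>E(U)\<close> rests on the unit of \<open>A\<close> having degree one, which has to be
  derived. The action on the induced module is a union over representatives of a coset. Its value is
  known only after the extension to the free group has been shown to preserve the subgroup of
  relations.\<close>

lemma hom_eq_on_generate:
  assumes "group G" "group H" "f \<in> hom G H" "f' \<in> hom G H" "S \<subseteq> carrier G"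
    and "\<And>s. s \<in> S \<Longrightarrow> f s = f' s" "x \<in> generate G S"
  shows "f x = f' x"
proof -
  interpret f: group_hom G H f
    using assms by (simp add: group_hom_def group_hom_axioms_def)
  interpret f': group_hom G H f'
    using assms by (simp add: group_hom_def group_hom_axioms_def)
  from assms(7) show ?thesis
  proof (induction rule: generate.induct)
    case (eng x y)
    then show ?case
      using group.generate_in_carrier[OF assms(1,5)] by simp
  qed (use assms(5,6) in \<open>auto simp: subset_iff\<close>)
qed

lemma hom_generate_subset:
  assumes "group G" "group H" "f \<in> hom G H" "S \<subseteq> carrier G" "subgroup K H" "f ` S \<subseteq> K"
  shows "f ` generate G S \<subseteq> K"
proof -
  interpret f: group_hom G H f
    using assms by (simp add: group_hom_def group_hom_axioms_def)
  have "f ` generate G S = generate H (f ` S)"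
    using f.generate_img[OF assms(4)] by simp
  then show ?thesis
    using group.generate_subgroup_incl[OF assms(2,6,5)] by simp
qed

text \<open>The ring multiplication of an induced module is an undefined record field, so maps
  between such modules are treated as group homomorphisms of the additive structure. This also gives
  access to the theory of generated subgroups.\<close>

abbreviation additive_hom ::
    "('a, 'm) ring_scheme \<Rightarrow> ('b, 'n) ring_scheme \<Rightarrow> ('a \<Rightarrow> 'b) set" where
  "additive_hom M N \<equiv> hom (add_monoid M) (add_monoid N)"

lemma additive_homI:
  assumes "\<And>x. x \<in> carrier M \<Longrightarrow> f x \<in> carrier N"
    and "\<And>x y. x \<in> carrier M \<Longrightarrow> y \<in> carrier M \<Longrightarrow> f (x \<oplus>\<^bsub>M\<^esub> y) = f x \<oplus>\<^bsub>N\<^esub> f y"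
  shows "f \<in> additive_hom M N"
  using assms by (simp add: hom_def)

lemma additive_homD:
  assumes "f \<in> additive_hom M N" "x \<in> carrier M"
  shows "f x \<in> carrier N"
    and "y \<in> carrier M \<Longrightarrow> f (x \<oplus>\<^bsub>M\<^esub> y) = f x \<oplus>\<^bsub>N\<^esub> f y"
  using assms by (auto simp: hom_def)

lemma additive_hom_zero:
  assumes "abelian_group M" "abelian_group N" "f \<in> additive_hom M N"
  shows "f \<zero>\<^bsub>M\<^esub> = \<zero>\<^bsub>N\<^esub>"
  using hom_one[OF assms(3)] assms(1,2)
  by (simp add: abelian_group.a_group)

lemma additive_hom_finsum:
  assumes "abelian_group M" "abelian_group N" "f \<in> additive_hom M N"
    and "finite I" "x \<in> I \<rightarrow> carrier M"
  shows "f (finsum M x I) = finsum N (\<lambda>i. f (x i)) I"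
proof -
  interpret M: abelian_group M by fact
  interpret N: abelian_group N by fact
  have "x ` J \<subseteq> carrier M \<Longrightarrow> f (finsum M x J) = finsum N (\<lambda>i. f (x i)) J" if "finite J" for J
    using that
  proof (induction J rule: finite_induct)
    case empty
    then show ?case by (simp add: additive_hom_zero assms)
  next
    case (insert j J)
    then have "x \<in> J \<rightarrow> carrier M" "x j \<in> carrier M" by auto
    moreover from this have "(\<lambda>i. f (x i)) \<in> J \<rightarrow> carrier N" "f (x j) \<in> carrier N"
      using additive_homD(1)[OF assms(3)] by auto
    ultimately show ?case
      using insert additive_homD(2)[OF assms(3)] by simp
  qed
  then show ?thesis using assms(4,5) by blast
qed

lemma additive_hom_comp:
  assumes "f \<in> additive_hom L M" "g \<in> additive_hom M N"
  shows "(\<lambda>x. g (f x)) \<in> additive_hom L N"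
  by (intro additive_homI) (simp_all add: additive_homD[OF assms(1)] additive_homD[OF assms(2)])

lemma additive_hom_sum:
  assumes "abelian_group N" "\<And>i. i \<in> I \<Longrightarrow> f i \<in> additive_hom M N"
  shows "(\<lambda>x. finsum N (\<lambda>i. f i x) I) \<in> additive_hom M N"
proof -
  interpret N: abelian_group N by fact
  have "(\<lambda>i. f i x) \<in> I \<rightarrow> carrier N" if "x \<in> carrier M" for x
    using assms(2) that by (auto dest: additive_homD(1))
  moreover have "finsum N (\<lambda>i. f i (x \<oplus>\<^bsub>M\<^esub> y)) I
      = finsum N (\<lambda>i. f i x \<oplus>\<^bsub>N\<^esub> f i y) I" if "x \<in> carrier M" "y \<in> carrier M" for x y
    using assms(2) that
    by (intro N.finsum_cong') (auto dest: additive_homD)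
  ultimately show ?thesis
    by (intro additive_homI) (auto simp: N.finsum_addf)
qed

lemma (in abelian_group) finsum_single:
  assumes "finite I" "i \<in> I" "x \<in> carrier G" "\<And>j. j \<in> I \<Longrightarrow> f j = (if j = i then x else \<zero>)"
  shows "finsum G f I = x"
proof -
  have "finsum G f I = finsum G (\<lambda>j. if i = j then x else \<zero>) I"
    using assms by (intro finsum_cong') auto
  also have "\<dots> = x"
    using add.finprod_singleton[of i I "\<lambda>_. x"] assms by simp
  finally show ?thesis .
qed

section \<open>Internal direct sums over a finite index set and their projections\<close>

locale direct_sum_decomposition = abelian_group M
  for M :: "('a, 'm) ring_scheme" (structure) and I :: "'i set" and D :: "'i \<Rightarrow> 'a set" +
  assumes finite_index: "finite I"
    and part_subgroup: "i \<in> I \<Longrightarrow> subgroup (D i) (add_monoid M)"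
    and decomposition: "x \<in> carrier M \<Longrightarrow>
      \<exists>!y. y \<in> (\<Pi>\<^sub>E i\<in>I. D i) \<and> x = (\<Oplus>i\<in>I. y i)"
begin

definition proj :: "'i \<Rightarrow> 'a \<Rightarrow> 'a" where
  "proj i x = (THE y. y \<in> (\<Pi>\<^sub>E i\<in>I. D i) \<and> x = (\<Oplus>i\<in>I. y i)) i"

lemma part_subset: "i \<in> I \<Longrightarrow> x \<in> D i \<Longrightarrow> x \<in> carrier M"
  using subgroup.subset[OF part_subgroup] by auto

lemma part_zero: "i \<in> I \<Longrightarrow> \<zero> \<in> D i"
  using subgroup.one_closed[OF part_subgroup] by auto

lemma part_add: "i \<in> I \<Longrightarrow> x \<in> D i \<Longrightarrow> y \<in> D i \<Longrightarrow> x \<oplus> y \<in> D i"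
  using subgroup.m_closed[OF part_subgroup] by auto

lemma
  assumes "x \<in> carrier M"
  shows proj_in_part: "i \<in> I \<Longrightarrow> proj i x \<in> D i"
    and sum_proj: "(\<Oplus>i\<in>I. proj i x) = x"
  using theI'[OF decomposition[OF assms]] unfolding proj_def by auto

lemma proj_closed: "x \<in> carrier M \<Longrightarrow> i \<in> I \<Longrightarrow> proj i x \<in> carrier M"
  by (blast intro: proj_in_part part_subset)

lemma proj_finsum:
  assumes "\<And>i. i \<in> I \<Longrightarrow> y i \<in> D i" "i \<in> I"
  shows "proj i (\<Oplus>i\<in>I. y i) = y i"
proof -
  let ?x = "\<Oplus>i\<in>I. y i"
  have y: "y \<in> I \<rightarrow> carrier M" using assms(1) part_subset by auto
  then have x: "?x \<in> carrier M" by simp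
  \<comment> \<open>The unique family is extensional, whereas \<open>y\<close> is unconstrained
    outside \<open>I\<close>; hence the restriction.\<close>
  have "(THE y'. y' \<in> (\<Pi>\<^sub>E i\<in>I. D i) \<and> ?x = (\<Oplus>i\<in>I. y' i)) = restrict y I"
  proof (rule the1_equality[OF decomposition[OF x]])
    have "?x = (\<Oplus>i\<in>I. restrict y I i)"
      using y by (intro finsum_cong') auto
    then show "restrict y I \<in> (\<Pi>\<^sub>E i\<in>I. D i) \<and> ?x = (\<Oplus>i\<in>I. restrict y I i)"
      using assms(1) by auto
  qed
  then show ?thesis using assms(2) by (simp add: proj_def)
qed

lemma proj_part:
  assumes "i \<in> I" "j \<in> I" "x \<in> D i"
  shows "proj j x = (if j = i then x else \<zero>)"
proof -
  let ?y = "\<lambda>j. if j = i then x else \<zero>"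
  have "x = (\<Oplus>j\<in>I. ?y j)"
    using assms part_subset by (intro finsum_single[symmetric] finite_index) auto
  moreover have "proj j (\<Oplus>j\<in>I. ?y j) = ?y j"
    using assms part_zero by (intro proj_finsum) auto
  ultimately show ?thesis by simp
qed

lemma proj_additive:
  assumes "i \<in> I"
  shows "proj i \<in> additive_hom M M"
proof (rule additive_homI)
  fix x y assume xy: "x \<in> carrier M" "y \<in> carrier M"
  have "proj i (\<Oplus>i\<in>I. proj i x \<oplus> proj i y) = proj i x \<oplus> proj i y"
    using xy assms by (intro proj_finsum) (auto intro: part_add proj_in_part)
  moreover have "(\<Oplus>i\<in>I. proj i x \<oplus> proj i y) = x \<oplus> y"
    using xy by (subst finsum_addf) (auto simp: sum_proj proj_closed)
  ultimately show "proj i (x \<oplus> y) = proj i x \<oplus> proj i y" by simp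
qed (use assms proj_closed in auto)

text \<open>Applying \<open>h\<close> to the components of \<open>x\<close> and reindexing along
  \<open>s\<close> yields a family with one member in each part and with sum \<open>h x\<close>; by
  uniqueness it consists of the components of \<open>h x\<close>. With \<open>s\<close> a left
  translation this covers multiplication by a homogeneous element, with \<open>s\<close> the
  identity it covers right multiplication by an element of degree one.\<close>

lemma proj_equivariant:
  assumes h: "h \<in> additive_hom M M" and s: "bij_betw s I I"
    and hs: "\<And>i y. i \<in> I \<Longrightarrow> y \<in> D i \<Longrightarrow> h y \<in> D (s i)"
    and x: "x \<in> carrier M" and i: "i \<in> I"
  shows "proj (s i) (h x) = h (proj i x)"
proof -
  let ?t = "inv_into I s"
  have t: "?t j \<in> I" "s (?t j) = j" if "j \<in> I" for j
    using s that by (auto simp: bij_betw_def inv_into_into f_inv_into_f)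
  have ts: "?t (s j) = j" if "j \<in> I" for j
    using s that by (auto simp: bij_betw_def)
  have sI: "s ` I = I" "inj_on s I" using s by (auto simp: bij_betw_def)
  \<comment> \<open>Indexed by the target: the member at \<open>j\<close> comes from the component
    of \<open>x\<close> at the preimage of \<open>j\<close> under \<open>s\<close>, so that it lies
    in \<open>D j\<close>.\<close>
  let ?y = "\<lambda>j. h (proj (?t j) x)"
  have y: "?y j \<in> D j" if "j \<in> I" for j
    using hs[OF t(1)[OF that] proj_in_part[OF x t(1)[OF that]]] t(2)[OF that] by simp
  have ag: "abelian_group M" by (rule abelian_group_axioms)
  have "h x = h (\<Oplus>i\<in>I. proj i x)" by (simp add: sum_proj x)
  also have "\<dots> = (\<Oplus>i\<in>I. h (proj i x))"
    using x by (intro additive_hom_finsum ag h finite_index) (auto simp: proj_closed)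
  also have "\<dots> = (\<Oplus>i\<in>I. ?y (s i))"
    using y sI(1) ts part_subset by (intro finsum_cong') (auto, metis imageI)
  also have "\<dots> = (\<Oplus>i\<in>s ` I. ?y i)"
    using y sI part_subset by (intro finsum_reindex[symmetric]) auto
  finally have "h x = (\<Oplus>j\<in>I. ?y j)" using sI by simp
  moreover have "proj (s i) (\<Oplus>j\<in>I. ?y j) = ?y (s i)"
    using y i sI by (intro proj_finsum) auto
  ultimately show ?thesis using ts[OF i] by simp
qed

end

text \<open>A complete system of orthogonal projections decomposes the group: the sum condition
  gives existence, and applying \<open>P j\<close> to any decomposition isolates its member at
  \<open>j\<close>, which gives uniqueness.\<close>

lemma direct_sum_decompositionI:
  fixes M (structure)
  assumes "abelian_group M" "finite I"
    and D: "\<And>i. i \<in> I \<Longrightarrow> subgroup (D i) (add_monoid M)"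
    and P: "\<And>i. i \<in> I \<Longrightarrow> P i \<in> additive_hom M M"
    and P_in: "\<And>i x. i \<in> I \<Longrightarrow> x \<in> carrier M \<Longrightarrow> P i x \<in> D i"
    and sum_P: "\<And>x. x \<in> carrier M \<Longrightarrow> (\<Oplus>i\<in>I. P i x) = x"
    and P_part: "\<And>i j x. i \<in> I \<Longrightarrow> j \<in> I \<Longrightarrow> x \<in> D i \<Longrightarrow> P j x = (if j = i then x else \<zero>)"
  shows "direct_sum_decomposition M I D"
proof -
  interpret abelian_group M by fact
  show ?thesis
  proof (intro direct_sum_decomposition.intro direct_sum_decomposition_axioms.intro)
    fix x assume x: "x \<in> carrier M"
    show "\<exists>!y. y \<in> (\<Pi>\<^sub>E i\<in>I. D i) \<and> x = (\<Oplus>i\<in>I. y i)"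
    proof (rule ex1I)
      have "x = (\<Oplus>i\<in>I. (\<lambda>i\<in>I. P i x) i)"
        using x P by (subst finsum_cong'[of _ _ "\<lambda>i. P i x"]) (auto simp: sum_P dest: additive_homD(1))
      then show "(\<lambda>i\<in>I. P i x) \<in> (\<Pi>\<^sub>E i\<in>I. D i) \<and> x = (\<Oplus>i\<in>I. (\<lambda>i\<in>I. P i x) i)"
        using P_in x by auto
    next
      fix y assume y: "y \<in> (\<Pi>\<^sub>E i\<in>I. D i) \<and> x = (\<Oplus>i\<in>I. y i)"
      have yc: "y i \<in> carrier M" if "i \<in> I" for i
        using y subgroup.subset[OF D[OF that]] that by auto
      have "y j = P j x" if "j \<in> I" for j
      proof -
        have "P j x = (\<Oplus>i\<in>I. P j (y i))"
          using y yc by (auto intro: additive_hom_finsum[OF _ _ P[OF that]] abelian_group_axioms assms(2))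
        also have "\<dots> = y j"
          using y yc P_part that assms(2) by (intro finsum_single[of _ j]) (auto simp: PiE_mem)
        finally show ?thesis by simp
      qed
      then show "y = (\<lambda>i\<in>I. P i x)"
        using y by (auto simp: PiE_iff extensional_def fun_eq_iff)
    qed
  qed (use assms in auto)
qed

section \<open>Opposite endomorphism algebras of graded modules\<close>

locale algebra_module = A: assoc_algebra R A + T: left_module A T
  for R :: "('o, 'm) ring_scheme" and A :: "('o, 'a, 'n) module_scheme"
    and T :: "('a, 't, 'k) module_scheme"
begin

abbreviation E where "E \<equiv> op_endo_algebra A T"

lemma endo_sel [simp]:
  "carrier E = module_endos A T"
  "f \<otimes>\<^bsub>E\<^esub> f' = compose (carrier T) f' f"
  "\<one>\<^bsub>E\<^esub> = (\<lambda>x\<in>carrier T. x)"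
  "\<zero>\<^bsub>E\<^esub> = (\<lambda>x\<in>carrier T. \<zero>\<^bsub>T\<^esub>)"
  "f \<oplus>\<^bsub>E\<^esub> f' = (\<lambda>x\<in>carrier T. f x \<oplus>\<^bsub>T\<^esub> f' x)"
  "r \<odot>\<^bsub>E\<^esub> f = (\<lambda>x\<in>carrier T. (r \<odot>\<^bsub>A\<^esub> \<one>\<^bsub>A\<^esub>) \<odot>\<^bsub>T\<^esub> f x)"
  by (simp_all add: op_endo_algebra_def)

text \<open>Endomorphisms are extensional functions, hence always built as restrictions. In return,
  agreement on the carrier is literal equality, and the algebra axioms can be checked
  pointwise.\<close>

lemma endoI:
  assumes "\<And>x. x \<in> carrier T \<Longrightarrow> f x \<in> carrier T"
    and "\<And>x y. x \<in> carrier T \<Longrightarrow> y \<in> carrier T \<Longrightarrow> f (x \<oplus>\<^bsub>T\<^esub> y) = f x \<oplus>\<^bsub>T\<^esub> f y"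
    and "\<And>a x. a \<in> carrier A \<Longrightarrow> x \<in> carrier T \<Longrightarrow> f (a \<odot>\<^bsub>T\<^esub> x) = a \<odot>\<^bsub>T\<^esub> f x"
  shows "restrict f (carrier T) \<in> module_endos A T"
  using assms by (auto simp: module_endos_def T.smult_closed)

lemma endoD [simp]:
  assumes "f \<in> module_endos A T" "x \<in> carrier T"
  shows "f x \<in> carrier T"
    and "y \<in> carrier T \<Longrightarrow> f (x \<oplus>\<^bsub>T\<^esub> y) = f x \<oplus>\<^bsub>T\<^esub> f y"
    and "a \<in> carrier A \<Longrightarrow> f (a \<odot>\<^bsub>T\<^esub> x) = a \<odot>\<^bsub>T\<^esub> f x"
  using assms by (auto simp: module_endos_def)

lemma endo_additive: "f \<in> module_endos A T \<Longrightarrow> f \<in> additive_hom T T"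
  by (intro additive_homI) simp_all

lemma endo_eqI:
  assumes "f \<in> module_endos A T" "f' \<in> module_endos A T"
    and "\<And>x. x \<in> carrier T \<Longrightarrow> f x = f' x"
  shows "f = f'"
proof (rule PiE_ext)
  show "f \<in> carrier T \<rightarrow>\<^sub>E carrier T" "f' \<in> carrier T \<rightarrow>\<^sub>E carrier T"
    using assms(1,2) unfolding module_endos_def by blast+
qed (rule assms(3))

lemma smult_additive:
  assumes "a \<in> carrier A"
  shows "(\<lambda>x. a \<odot>\<^bsub>T\<^esub> x) \<in> additive_hom T T"
  using assms by (intro additive_homI) (auto simp: T.smult_closed T.smult_r_distr)

lemma smult_minus_right:
  assumes "a \<in> carrier A" "x \<in> carrier T"
  shows "a \<odot>\<^bsub>T\<^esub> (\<ominus>\<^bsub>T\<^esub> x) = \<ominus>\<^bsub>T\<^esub> (a \<odot>\<^bsub>T\<^esub> x)"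
proof -
  have "a \<odot>\<^bsub>T\<^esub> (\<ominus>\<^bsub>T\<^esub> x) \<oplus>\<^bsub>T\<^esub> a \<odot>\<^bsub>T\<^esub> x = a \<odot>\<^bsub>T\<^esub> \<zero>\<^bsub>T\<^esub>"
    using assms by (simp add: T.smult_r_distr[symmetric] T.M.l_neg)
  also have "\<dots> = \<zero>\<^bsub>T\<^esub>"
    using assms additive_hom_zero[OF _ _ smult_additive] T.M.abelian_group_axioms by blast
  finally show ?thesis
    using T.M.minus_equality[of "a \<odot>\<^bsub>T\<^esub> (\<ominus>\<^bsub>T\<^esub> x)" "a \<odot>\<^bsub>T\<^esub> x"] assms
    by (simp add: T.smult_closed)
qed

lemma scalar_closed: "r \<in> carrier R \<Longrightarrow> r \<odot>\<^bsub>A\<^esub> \<one>\<^bsub>A\<^esub> \<in> carrier A"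
  by (simp add: A.smult_closed)

lemma scalar_central:
  assumes "r \<in> carrier R" "a \<in> carrier A"
  shows "(r \<odot>\<^bsub>A\<^esub> \<one>\<^bsub>A\<^esub>) \<otimes>\<^bsub>A\<^esub> a = r \<odot>\<^bsub>A\<^esub> a" "a \<otimes>\<^bsub>A\<^esub> (r \<odot>\<^bsub>A\<^esub> \<one>\<^bsub>A\<^esub>) = r \<odot>\<^bsub>A\<^esub> a"
  using assms by (simp_all add: A.smult_mult_left A.smult_mult_right)

text \<open>The element \<open>r \<odot> 1\<close> is central in \<open>A\<close>, so its action on
  \<open>T\<close> is \<open>A\<close>-linear. This is what makes a scalar multiple of an
  endomorphism an endomorphism again.\<close>

lemma scalar_commute:
  assumes "r \<in> carrier R" "a \<in> carrier A" "x \<in> carrier T"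
  shows "(r \<odot>\<^bsub>A\<^esub> \<one>\<^bsub>A\<^esub>) \<odot>\<^bsub>T\<^esub> (a \<odot>\<^bsub>T\<^esub> x) = a \<odot>\<^bsub>T\<^esub> ((r \<odot>\<^bsub>A\<^esub> \<one>\<^bsub>A\<^esub>) \<odot>\<^bsub>T\<^esub> x)"
  using assms by (simp add: T.smult_assoc[symmetric] scalar_closed scalar_central)

lemma endo_comp_closed:
  "f \<in> module_endos A T \<Longrightarrow> f' \<in> module_endos A T \<Longrightarrow>
    compose (carrier T) f' f \<in> module_endos A T"
  unfolding compose_def by (intro endoI) simp_all

lemma endo_id_closed: "(\<lambda>x\<in>carrier T. x) \<in> module_endos A T"
  by (intro endoI) simp_all

lemma endo_zero_closed: "(\<lambda>x\<in>carrier T. \<zero>\<^bsub>T\<^esub>) \<in> module_endos A T"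
  using additive_hom_zero[OF _ _ smult_additive] T.M.abelian_group_axioms
  by (intro endoI) auto

lemma endo_add_closed:
  "f \<in> module_endos A T \<Longrightarrow> f' \<in> module_endos A T \<Longrightarrow>
    (\<lambda>x\<in>carrier T. f x \<oplus>\<^bsub>T\<^esub> f' x) \<in> module_endos A T"
  by (intro endoI) (simp_all add: T.smult_r_distr T.M.a_ac)

lemma endo_minus_closed:
  "f \<in> module_endos A T \<Longrightarrow> (\<lambda>x\<in>carrier T. \<ominus>\<^bsub>T\<^esub> f x) \<in> module_endos A T"
  by (intro endoI) (simp_all add: smult_minus_right T.M.minus_add)

lemma endo_smult_closed:
  "r \<in> carrier R \<Longrightarrow> f \<in> module_endos A T \<Longrightarrow>
    (\<lambda>x\<in>carrier T. (r \<odot>\<^bsub>A\<^esub> \<one>\<^bsub>A\<^esub>) \<odot>\<^bsub>T\<^esub> f x) \<in> module_endos A T"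
  by (intro endoI) (simp_all add: T.smult_closed T.smult_r_distr scalar_closed scalar_commute)

lemma endo_abelian_group: "abelian_group E"
proof (rule abelian_groupI)
  fix f assume f: "f \<in> carrier E"
  have "(\<lambda>x\<in>carrier T. \<ominus>\<^bsub>T\<^esub> f x) \<oplus>\<^bsub>E\<^esub> f = \<zero>\<^bsub>E\<^esub>"
    using f by (auto simp: fun_eq_iff T.M.l_neg)
  then show "\<exists>f'\<in>carrier E. f' \<oplus>\<^bsub>E\<^esub> f = \<zero>\<^bsub>E\<^esub>"
    using endo_minus_closed[of f] f unfolding endo_sel(1) by blast
next
  fix f assume f: "f \<in> carrier E"
  show "\<zero>\<^bsub>E\<^esub> \<oplus>\<^bsub>E\<^esub> f = f"
    using f endo_add_closed[OF endo_zero_closed, of f] by (intro endo_eqI) simp_all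
next
  fix f f' f'' assume "f \<in> carrier E" "f' \<in> carrier E" "f'' \<in> carrier E"
  then show "f \<oplus>\<^bsub>E\<^esub> f' \<oplus>\<^bsub>E\<^esub> f'' = f \<oplus>\<^bsub>E\<^esub> (f' \<oplus>\<^bsub>E\<^esub> f'')"
    by (simp add: fun_eq_iff T.M.a_assoc)
next
  fix f f' assume "f \<in> carrier E" "f' \<in> carrier E"
  then show "f \<oplus>\<^bsub>E\<^esub> f' = f' \<oplus>\<^bsub>E\<^esub> f"
    by (simp add: fun_eq_iff T.M.a_comm)
qed (simp_all only: endo_sel endo_add_closed endo_zero_closed)

lemma endo_monoid: "monoid E"
proof (rule monoidI)
  fix f assume f: "f \<in> carrier E"
  show "\<one>\<^bsub>E\<^esub> \<otimes>\<^bsub>E\<^esub> f = f" "f \<otimes>\<^bsub>E\<^esub> \<one>\<^bsub>E\<^esub> = f"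
    using f endo_comp_closed[OF endo_id_closed] endo_comp_closed[OF _ endo_id_closed]
    by (intro endo_eqI; simp add: compose_eq)+
next
  fix f f' f'' assume "f \<in> carrier E" "f' \<in> carrier E" "f'' \<in> carrier E"
  then show "f \<otimes>\<^bsub>E\<^esub> f' \<otimes>\<^bsub>E\<^esub> f'' = f \<otimes>\<^bsub>E\<^esub> (f' \<otimes>\<^bsub>E\<^esub> f'')"
    by (simp add: compose_def fun_eq_iff)
qed (auto intro: endo_comp_closed endo_id_closed)

lemma endo_ring: "ring E"
  using endo_abelian_group endo_monoid
proof (rule ringI)
  fix f f' f'' assume "f \<in> carrier E" "f' \<in> carrier E" "f'' \<in> carrier E"
  then show "(f \<oplus>\<^bsub>E\<^esub> f') \<otimes>\<^bsub>E\<^esub> f'' = f \<otimes>\<^bsub>E\<^esub> f'' \<oplus>\<^bsub>E\<^esub> f' \<otimes>\<^bsub>E\<^esub> f''"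
    "f'' \<otimes>\<^bsub>E\<^esub> (f \<oplus>\<^bsub>E\<^esub> f') = f'' \<otimes>\<^bsub>E\<^esub> f \<oplus>\<^bsub>E\<^esub> f'' \<otimes>\<^bsub>E\<^esub> f'"
    by (simp_all add: compose_def fun_eq_iff)
qed

lemma endo_module: "module R E"
proof (rule moduleI)
  show "cring R" by (rule A.R.is_cring)
  show "abelian_group E" by (rule endo_abelian_group)
next
  fix r s f assume "r \<in> carrier R" "s \<in> carrier R" "f \<in> carrier E"
  then show "(r \<oplus>\<^bsub>R\<^esub> s) \<odot>\<^bsub>E\<^esub> f = (r \<odot>\<^bsub>E\<^esub> f) \<oplus>\<^bsub>E\<^esub> (s \<odot>\<^bsub>E\<^esub> f)"
    by (simp add: fun_eq_iff A.smult_l_distr T.smult_l_distr scalar_closed)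
next
  fix r s f assume rs: "r \<in> carrier R" "s \<in> carrier R" and f: "f \<in> carrier E"
  have "(r \<otimes>\<^bsub>R\<^esub> s) \<odot>\<^bsub>A\<^esub> \<one>\<^bsub>A\<^esub> = (r \<odot>\<^bsub>A\<^esub> \<one>\<^bsub>A\<^esub>) \<otimes>\<^bsub>A\<^esub> (s \<odot>\<^bsub>A\<^esub> \<one>\<^bsub>A\<^esub>)"
    using rs by (simp add: scalar_central(1) scalar_closed A.smult_assoc1)
  then show "(r \<otimes>\<^bsub>R\<^esub> s) \<odot>\<^bsub>E\<^esub> f = r \<odot>\<^bsub>E\<^esub> (s \<odot>\<^bsub>E\<^esub> f)"
    using rs f by (simp add: fun_eq_iff T.smult_assoc scalar_closed)
next
  fix f assume "f \<in> carrier E"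
  then show "\<one>\<^bsub>R\<^esub> \<odot>\<^bsub>E\<^esub> f = f"
    using endo_smult_closed[of "\<one>\<^bsub>R\<^esub>" f]
    by (intro endo_eqI) (simp_all add: T.smult_one)
next
  fix r f f' assume "r \<in> carrier R" "f \<in> carrier E" "f' \<in> carrier E"
  then show "r \<odot>\<^bsub>E\<^esub> (f \<oplus>\<^bsub>E\<^esub> f') = (r \<odot>\<^bsub>E\<^esub> f) \<oplus>\<^bsub>E\<^esub> (r \<odot>\<^bsub>E\<^esub> f')"
    by (simp add: fun_eq_iff T.smult_r_distr scalar_closed)
qed (simp_all only: endo_sel endo_smult_closed)

text \<open>Bilinearity of the product over the ground ring is the \<open>A\<close>-linearity of
  endomorphisms, used for the elements \<open>r \<odot> 1\<close>.\<close>

lemma endo_algebra: "assoc_algebra R E"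
  using endo_module endo_ring
  by (intro assoc_algebra.intro assoc_algebra_axioms.intro)
     (simp_all add: compose_def fun_eq_iff T.smult_closed scalar_closed)

text \<open>Evaluation at \<open>x\<close> is an additive map from the endomorphism algebra to
  \<open>T\<close>.\<close>

lemma endo_finsum_apply:
  assumes "finite I" "\<And>i. i \<in> I \<Longrightarrow> f i \<in> module_endos A T" "x \<in> carrier T"
  shows "finsum E f I x = finsum T (\<lambda>i. f i x) I"
proof -
  have "(\<lambda>f. f x) \<in> additive_hom E T"
    using assms(3) by (intro additive_homI) auto
  from additive_hom_finsum[OF endo_abelian_group T.M.abelian_group_axioms this assms(1)]
  show ?thesis using assms(2) by auto
qed

end

lemma (in group) bij_betw_translate:
  "g \<in> carrier G \<Longrightarrow> bij_betw (\<lambda>x. g \<otimes> x) (carrier G) (carrier G)"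
  by (simp add: bij_betw_def inj_on_cmult surj_const_mult)

section \<open>Component projections of a graded algebra and the degree of its unit\<close>

context graded_algebra
begin

lemma gr_decomposition: "direct_sum_decomposition A (carrier G) gr"
proof (intro direct_sum_decomposition.intro direct_sum_decomposition_axioms.intro)
  show "subgroup (gr g) (add_monoid A)" if "g \<in> carrier G" for g
    by (rule submodule.axioms(1)[OF comp_submodule[OF that]])
qed (rule M.abelian_group_axioms finite_G direct_sum | assumption)+

sublocale D: direct_sum_decomposition A "carrier G" gr
  by (rule gr_decomposition)

lemma left_mult_additive: "a \<in> carrier A \<Longrightarrow> (\<lambda>x. a \<otimes>\<^bsub>A\<^esub> x) \<in> additive_hom A A"
  and right_mult_additive: "a \<in> carrier A \<Longrightarrow> (\<lambda>x. x \<otimes>\<^bsub>A\<^esub> a) \<in> additive_hom A A"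
  by (auto intro!: additive_homI simp: r_distr l_distr)

text \<open>The case of \<open>proj_equivariant\<close> in which the permutation of degrees is left
  translation by \<open>k\<close>.\<close>

lemma proj_left_mult:
  assumes "k \<in> carrier G" "g \<in> carrier G" "a \<in> gr k" "x \<in> carrier A"
  shows "D.proj (k \<otimes>\<^bsub>G\<^esub> g) (a \<otimes>\<^bsub>A\<^esub> x) = a \<otimes>\<^bsub>A\<^esub> D.proj g x"
  using assms D.part_subset[of k a]
  by (intro D.proj_equivariant left_mult_additive G.bij_betw_translate) (auto intro: comp_mult)

lemma proj_right_mult:
  assumes "g \<in> carrier G" "b \<in> gr \<one>\<^bsub>G\<^esub>" "x \<in> carrier A"
  shows "D.proj g (x \<otimes>\<^bsub>A\<^esub> b) = D.proj g x \<otimes>\<^bsub>A\<^esub> b"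
proof -
  have "bij_betw (\<lambda>g. g) (carrier G) (carrier G)" using bij_betw_id[unfolded id_def] .
  moreover have "y \<otimes>\<^bsub>A\<^esub> b \<in> gr i" if "i \<in> carrier G" "y \<in> gr i" for i y
    using comp_mult[of i "\<one>\<^bsub>G\<^esub>" y b] that assms by simp
  ultimately show ?thesis
    using D.proj_equivariant[OF right_mult_additive, of b "\<lambda>g. g" x g] assms
      D.part_subset[of "\<one>\<^bsub>G\<^esub>" b] by simp
qed

text \<open>The identity component \<open>e\<close> of the unit satisfies \<open>a e = a\<close> for homogeneous \<open>a\<close>, hence for
  all \<open>a\<close>, so that \<open>e = 1\<close>.\<close>
lemma one_in_identity_component: "\<one>\<^bsub>A\<^esub> \<in> gr \<one>\<^bsub>G\<^esub>"
proof -
  define e where "e = D.proj \<one>\<^bsub>G\<^esub> \<one>\<^bsub>A\<^esub>"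
  have e: "e \<in> gr \<one>\<^bsub>G\<^esub>" "e \<in> carrier A"
    unfolding e_def by (simp_all add: D.proj_in_part D.proj_closed)
  have unit: "a \<otimes>\<^bsub>A\<^esub> e = a" if "g \<in> carrier G" "a \<in> gr g" for g a
  proof -
    have ac: "a \<in> carrier A" using D.part_subset that by blast
    have "a \<otimes>\<^bsub>A\<^esub> e = D.proj (g \<otimes>\<^bsub>G\<^esub> \<one>\<^bsub>G\<^esub>) (a \<otimes>\<^bsub>A\<^esub> \<one>\<^bsub>A\<^esub>)"
      unfolding e_def using that by (subst proj_left_mult) auto
    also have "\<dots> = a" using that ac by (simp add: D.proj_part)
    finally show ?thesis .
  qed
  have AA: "abelian_group A" by (rule M.abelian_group_axioms)
  have "\<one>\<^bsub>A\<^esub> \<otimes>\<^bsub>A\<^esub> e = (\<Oplus>\<^bsub>A\<^esub>g\<in>carrier G. D.proj g \<one>\<^bsub>A\<^esub>) \<otimes>\<^bsub>A\<^esub> e"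
    by (simp add: D.sum_proj)
  also have "\<dots> = (\<Oplus>\<^bsub>A\<^esub>g\<in>carrier G. D.proj g \<one>\<^bsub>A\<^esub> \<otimes>\<^bsub>A\<^esub> e)"
    by (rule additive_hom_finsum[OF AA AA right_mult_additive[OF e(2)] finite_G])
       (simp add: D.proj_closed)
  also have "\<dots> = (\<Oplus>\<^bsub>A\<^esub>g\<in>carrier G. D.proj g \<one>\<^bsub>A\<^esub>)"
    by (intro finsum_cong') (simp_all add: unit D.proj_in_part D.proj_closed)
  also have "\<dots> = \<one>\<^bsub>A\<^esub>" by (simp add: D.sum_proj)
  finally show ?thesis using e by simp
qed

end

section \<open>Graded modules and the grading of their opposite endomorphism algebras\<close>

locale graded_module = graded_algebra R G A gr + algebra_module R A T +
    T: direct_sum_decomposition T "carrier G" D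
  for R :: "('o, 'm) ring_scheme" and G :: "('g, 'q) monoid_scheme"
    and A :: "('o, 'a, 'n) module_scheme" and gr :: "'g \<Rightarrow> 'a set"
    and T :: "('a, 't, 'k) module_scheme" and D :: "'g \<Rightarrow> 't set" +
  assumes smult_part: "g \<in> carrier G \<Longrightarrow> h \<in> carrier G \<Longrightarrow> a \<in> gr g \<Longrightarrow> x \<in> D h \<Longrightarrow>
      a \<odot>\<^bsub>T\<^esub> x \<in> D (g \<otimes>\<^bsub>G\<^esub> h)"
begin

text \<open>Degrees are shifted on the right because the action of \<open>A\<close> already shifts
  them on the left, and left and right translations of a group commute.\<close>

definition endo_part :: "'g \<Rightarrow> ('t \<Rightarrow> 't) set" where
  "endo_part h = {f \<in> module_endos A T. \<forall>g\<in>carrier G. f ` D g \<subseteq> D (g \<otimes>\<^bsub>G\<^esub> h)}"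

lemma endo_partI:
  assumes "f \<in> module_endos A T" "\<And>g x. g \<in> carrier G \<Longrightarrow> x \<in> D g \<Longrightarrow> f x \<in> D (g \<otimes>\<^bsub>G\<^esub> h)"
  shows "f \<in> endo_part h"
  using assms by (auto simp: endo_part_def)

lemma endo_partD:
  assumes "f \<in> endo_part h"
  shows "f \<in> module_endos A T" "g \<in> carrier G \<Longrightarrow> x \<in> D g \<Longrightarrow> f x \<in> D (g \<otimes>\<^bsub>G\<^esub> h)"
  using assms by (auto simp: endo_part_def)

definition endo_proj :: "'g \<Rightarrow> ('t \<Rightarrow> 't) \<Rightarrow> 't \<Rightarrow> 't" where
  "endo_proj h f = (\<lambda>x\<in>carrier T. finsum T (\<lambda>g. T.proj (g \<otimes>\<^bsub>G\<^esub> h) (f (T.proj g x))) (carrier G))"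

lemma endo_proj_additive:
  assumes h: "h \<in> carrier G" and f: "f \<in> module_endos A T"
  shows "(\<lambda>x. finsum T (\<lambda>g. T.proj (g \<otimes>\<^bsub>G\<^esub> h) (f (T.proj g x))) (carrier G)) \<in> additive_hom T T"
proof (rule additive_hom_sum[OF T.M.abelian_group_axioms])
  fix g assume g: "g \<in> carrier G"
  show "(\<lambda>x. T.proj (g \<otimes>\<^bsub>G\<^esub> h) (f (T.proj g x))) \<in> additive_hom T T"
    by (rule additive_hom_comp[OF additive_hom_comp[OF T.proj_additive[OF g] endo_additive[OF f]]
          T.proj_additive]) (simp add: g h)
qed

lemma proj_smult:
  assumes "k \<in> carrier G" "a \<in> gr k" "a \<in> carrier A" "x \<in> carrier T" "g \<in> carrier G"
  shows "T.proj (k \<otimes>\<^bsub>G\<^esub> g) (a \<odot>\<^bsub>T\<^esub> x) = a \<odot>\<^bsub>T\<^esub> T.proj g x"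
  using assms
  by (intro T.proj_equivariant smult_additive G.bij_betw_translate) (auto intro: smult_part)

text \<open>For \<open>a\<close> of degree \<open>k\<close>, the summand at \<open>k g\<close>
  applied to \<open>a x\<close> equals \<open>a\<close> times the summand at \<open>g\<close>
  applied to \<open>x\<close>: the first projection and \<open>f\<close> let \<open>a\<close> pass,
  and the second projection does so by associativity of the group. Translating the index by
  \<open>k\<close> gives linearity over homogeneous elements, and additivity in \<open>a\<close>
  gives the rest.\<close>

lemma endo_proj_closed:
  assumes h: "h \<in> carrier G" and f: "f \<in> module_endos A T"
  shows "endo_proj h f \<in> module_endos A T"
proof -
  define F where "F x = finsum T (\<lambda>g. T.proj (g \<otimes>\<^bsub>G\<^esub> h) (f (T.proj g x))) (carrier G)" for x
  note F = endo_proj_additive[OF h f, folded F_def]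
  have Fc: "F x \<in> carrier T" if "x \<in> carrier T" for x
    using additive_homD(1)[OF F] that by blast
  have hom: "F (a \<odot>\<^bsub>T\<^esub> x) = a \<odot>\<^bsub>T\<^esub> F x" if k: "k \<in> carrier G" and a: "a \<in> gr k" and x: "x \<in> carrier T" for k a x
  proof -
    have ac: "a \<in> carrier A" using D.part_subset k a by blast
    have ax: "a \<odot>\<^bsub>T\<^esub> x \<in> carrier T" using ac x by (rule T.smult_closed)
    have closed: "T.proj (g \<otimes>\<^bsub>G\<^esub> h) (f (T.proj g y)) \<in> carrier T"
      if "g \<in> carrier G" "y \<in> carrier T" for g y
      using that h f by (simp add: T.proj_closed)
    have "F (a \<odot>\<^bsub>T\<^esub> x) = finsum T (\<lambda>g. T.proj (g \<otimes>\<^bsub>G\<^esub> h) (f (T.proj g (a \<odot>\<^bsub>T\<^esub> x))))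
        ((\<lambda>x. k \<otimes>\<^bsub>G\<^esub> x) ` carrier G)"
      using G.bij_betw_translate[OF k] by (simp add: F_def bij_betw_def)
    also have "\<dots> = finsum T (\<lambda>g. T.proj (k \<otimes>\<^bsub>G\<^esub> g \<otimes>\<^bsub>G\<^esub> h) (f (T.proj (k \<otimes>\<^bsub>G\<^esub> g) (a \<odot>\<^bsub>T\<^esub> x)))) (carrier G)"
      using G.bij_betw_translate[OF k] closed ax k
      by (intro T.finsum_reindex) (auto simp: bij_betw_def)
    also have "\<dots> = finsum T (\<lambda>g. a \<odot>\<^bsub>T\<^esub> T.proj (g \<otimes>\<^bsub>G\<^esub> h) (f (T.proj g x))) (carrier G)"
      using k a ac x h f closed
      by (intro T.finsum_cong') (auto simp: proj_smult T.proj_closed G.m_assoc T.smult_closed)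
    also have "\<dots> = a \<odot>\<^bsub>T\<^esub> F x"
      unfolding F_def using closed x
      by (intro additive_hom_finsum[OF T.M.abelian_group_axioms T.M.abelian_group_axioms smult_additive[OF ac] finite_G, symmetric]) auto
    finally show ?thesis .
  qed
  have lin: "F (a \<odot>\<^bsub>T\<^esub> x) = a \<odot>\<^bsub>T\<^esub> F x" if a: "a \<in> carrier A" and x: "x \<in> carrier T" for a x
  proof -
    \<comment> \<open>With \<open>x\<close> fixed, both sides are additive in the scalar, so
      \<open>a\<close> may be replaced by the sum of its homogeneous components.\<close>
    have lr: "(\<lambda>a. F (a \<odot>\<^bsub>T\<^esub> x)) \<in> additive_hom A T" "(\<lambda>a. a \<odot>\<^bsub>T\<^esub> F x) \<in> additive_hom A T"
      by (rule additive_homI; simp add: x Fc T.smult_closed T.smult_l_distr additive_homD(2)[OF F])+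
    obtain y where y: "y \<in> (\<Pi>\<^sub>E g\<in>carrier G. gr g)" "a = finsum A y (carrier G)"
      using direct_sum[OF a] by blast
    have yc: "y \<in> carrier G \<rightarrow> carrier A" using y(1) by (auto intro: D.part_subset)
    have AT: "abelian_group A" "abelian_group T"
      by (rule M.abelian_group_axioms, rule T.M.abelian_group_axioms)
    have "F (a \<odot>\<^bsub>T\<^esub> x) = finsum T (\<lambda>g. F (y g \<odot>\<^bsub>T\<^esub> x)) (carrier G)"
      unfolding y(2) by (rule additive_hom_finsum[OF AT lr(1) finite_G yc])
    also have "\<dots> = finsum T (\<lambda>g. y g \<odot>\<^bsub>T\<^esub> F x) (carrier G)"
      using hom x y(1) yc Fc by (intro T.finsum_cong') (auto simp: T.smult_closed Pi_iff)
    also have "\<dots> = a \<odot>\<^bsub>T\<^esub> F x"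
      unfolding y(2) by (rule additive_hom_finsum[OF AT lr(2) finite_G yc, symmetric])
    finally show ?thesis .
  qed
  show ?thesis
    unfolding endo_proj_def F_def[symmetric]
    using Fc lin additive_homD(2)[OF F] by (intro endoI) auto
qed

text \<open>For \<open>x\<close> in \<open>D g\<close> all projections other than the one at
  \<open>g\<close> vanish, so a single summand survives. On homogeneous elements the component of
  degree \<open>h\<close> is thus the part of \<open>f x\<close> in the expected degree.\<close>

lemma endo_proj_apply_part:
  assumes h: "h \<in> carrier G" and f: "f \<in> module_endos A T" and g: "g \<in> carrier G" and x: "x \<in> D g"
  shows "endo_proj h f x = T.proj (g \<otimes>\<^bsub>G\<^esub> h) (f x)"
proof -
  have xc: "x \<in> carrier T" using T.part_subset g x .
  have 0: "f \<zero>\<^bsub>T\<^esub> = \<zero>\<^bsub>T\<^esub>" "\<And>i. i \<in> carrier G \<Longrightarrow> T.proj i \<zero>\<^bsub>T\<^esub> = \<zero>\<^bsub>T\<^esub>"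
    using additive_hom_zero[OF T.M.abelian_group_axioms T.M.abelian_group_axioms]
      endo_additive[OF f] T.proj_additive by blast+
  have "finsum T (\<lambda>k. T.proj (k \<otimes>\<^bsub>G\<^esub> h) (f (T.proj k x))) (carrier G) = T.proj (g \<otimes>\<^bsub>G\<^esub> h) (f x)"
  proof (rule T.finsum_single[OF finite_G g])
    show "T.proj (g \<otimes>\<^bsub>G\<^esub> h) (f x) \<in> carrier T"
      using f g h xc by (simp add: T.proj_closed)
    show "T.proj (k \<otimes>\<^bsub>G\<^esub> h) (f (T.proj k x)) = (if k = g then T.proj (g \<otimes>\<^bsub>G\<^esub> h) (f x) else \<zero>\<^bsub>T\<^esub>)"
      if k: "k \<in> carrier G" for k
      using T.proj_part[OF g k x] k h by (simp add: 0)
  qed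
  then show ?thesis using xc by (simp add: endo_proj_def)
qed

lemma endo_proj_in_part:
  assumes "h \<in> carrier G" "f \<in> module_endos A T"
  shows "endo_proj h f \<in> endo_part h"
proof (rule endo_partI)
  show "endo_proj h f \<in> module_endos A T" using assms by (rule endo_proj_closed)
  show "endo_proj h f x \<in> D (g \<otimes>\<^bsub>G\<^esub> h)" if "g \<in> carrier G" "x \<in> D g" for g x
    unfolding endo_proj_apply_part[OF assms that]
    using assms that T.part_subset[OF that] by (intro T.proj_in_part) simp_all
qed

lemma endo_part_subset: "h \<in> carrier G \<Longrightarrow> endo_part h \<subseteq> module_endos A T"
  by (auto simp: endo_part_def)

text \<open>Scalars act on endomorphisms through these elements; having degree one, they leave every
  \<open>D g\<close> invariant.\<close>

lemma scalar_in_identity_component: "r \<in> carrier R \<Longrightarrow> r \<odot>\<^bsub>A\<^esub> \<one>\<^bsub>A\<^esub> \<in> gr \<one>\<^bsub>G\<^esub>"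
  by (simp add: submodule.smult_closed[OF comp_submodule] one_in_identity_component)

lemma part_minus: "g \<in> carrier G \<Longrightarrow> x \<in> D g \<Longrightarrow> \<ominus>\<^bsub>T\<^esub> x \<in> D g"
  using subgroup.m_inv_closed[OF T.part_subgroup] by (simp add: a_inv_def)

lemma endo_part_submodule:
  assumes h: "h \<in> carrier G"
  shows "submodule (endo_part h) R E"
proof (rule module.submoduleI[OF endo_module])
  interpret EG: abelian_group E by (rule endo_abelian_group)
  show "endo_part h \<subseteq> carrier E" using endo_part_subset[OF h] by simp
  show "\<zero>\<^bsub>E\<^esub> \<in> endo_part h"
    using h by (intro endo_partI) (simp_all add: endo_zero_closed T.part_subset T.part_zero)
  show "\<ominus>\<^bsub>E\<^esub> f \<in> endo_part h" if f: "f \<in> endo_part h" for f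
  proof -
    note fE = endo_partD(1)[OF f]
    \<comment> \<open>The record has no field for the additive inverse, so the negative of
      \<open>f\<close> is first identified with the pointwise one by uniqueness of inverses.\<close>
    have "(\<lambda>x\<in>carrier T. \<ominus>\<^bsub>T\<^esub> f x) \<oplus>\<^bsub>E\<^esub> f = \<zero>\<^bsub>E\<^esub>"
      using fE by (simp add: fun_eq_iff T.M.l_neg)
    then have "\<ominus>\<^bsub>E\<^esub> f = (\<lambda>x\<in>carrier T. \<ominus>\<^bsub>T\<^esub> f x)"
      using fE endo_minus_closed[OF fE] by (intro EG.minus_equality) simp_all
    then show ?thesis
      using h endo_minus_closed[OF fE] endo_partD(2)[OF f]
      by (intro endo_partI) (simp_all add: T.part_subset part_minus)
  qed
  show "f \<oplus>\<^bsub>E\<^esub> f' \<in> endo_part h" if "f \<in> endo_part h" "f' \<in> endo_part h" for f f'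
    using that[THEN endo_partD(1)] that[THEN endo_partD(2)] h
    by (intro endo_partI) (simp_all add: endo_add_closed T.part_subset T.part_add)
  show "r \<odot>\<^bsub>E\<^esub> f \<in> endo_part h" if r: "r \<in> carrier R" and f: "f \<in> endo_part h" for r f
  proof -
    have "(r \<odot>\<^bsub>A\<^esub> \<one>\<^bsub>A\<^esub>) \<odot>\<^bsub>T\<^esub> f x \<in> D (g \<otimes>\<^bsub>G\<^esub> h)" if "g \<in> carrier G" "x \<in> D g" for g x
      using smult_part[of "\<one>\<^bsub>G\<^esub>" "g \<otimes>\<^bsub>G\<^esub> h" "r \<odot>\<^bsub>A\<^esub> \<one>\<^bsub>A\<^esub>" "f x"] that h
        endo_partD(2)[OF f] scalar_in_identity_component[OF r] by simp
    then show ?thesis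
      using endo_smult_closed[OF r endo_partD(1)[OF f]] h
      by (intro endo_partI) (simp_all add: T.part_subset)
  qed
qed

text \<open>The opposite product applies \<open>f\<close> before \<open>f'\<close>, so
  \<open>g\<close> passes to \<open>g h\<close> and then to \<open>g h k\<close>. Composition in the
  usual order would produce the degree \<open>k h\<close>.\<close>

lemma endo_part_mult:
  assumes "h \<in> carrier G" "k \<in> carrier G" "f \<in> endo_part h" "f' \<in> endo_part k"
  shows "f \<otimes>\<^bsub>E\<^esub> f' \<in> endo_part (h \<otimes>\<^bsub>G\<^esub> k)"
proof (rule endo_partI)
  show "f \<otimes>\<^bsub>E\<^esub> f' \<in> module_endos A T"
    using assms(3,4)[THEN endo_partD(1)] by (simp add: endo_comp_closed)
  fix g x assume g: "g \<in> carrier G" and x: "x \<in> D g"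
  have "f' (f x) \<in> D (g \<otimes>\<^bsub>G\<^esub> h \<otimes>\<^bsub>G\<^esub> k)"
    using endo_partD(2)[OF assms(4), of "g \<otimes>\<^bsub>G\<^esub> h"] endo_partD(2)[OF assms(3) g x] g assms(1)
    by simp
  then show "(f \<otimes>\<^bsub>E\<^esub> f') x \<in> D (g \<otimes>\<^bsub>G\<^esub> (h \<otimes>\<^bsub>G\<^esub> k))"
    using assms(1,2) g T.part_subset[OF g x] by (simp add: G.m_assoc compose_eq)
qed

lemma endo_apply_eq_sum:
  assumes "f \<in> module_endos A T" "x \<in> carrier T"
  shows "f x = finsum T (\<lambda>g. f (T.proj g x)) (carrier G)"
proof -
  have "f x = f (finsum T (\<lambda>g. T.proj g x) (carrier G))" using assms by (simp add: T.sum_proj)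
  also have "\<dots> = finsum T (\<lambda>g. f (T.proj g x)) (carrier G)"
    by (rule additive_hom_finsum[OF T.M.abelian_group_axioms T.M.abelian_group_axioms
          endo_additive[OF assms(1)] finite_G]) (simp add: assms(2) T.proj_closed)
  finally show ?thesis .
qed

lemma endo_eq_on_partsI:
  assumes "f \<in> module_endos A T" "f' \<in> module_endos A T"
    and "\<And>g x. g \<in> carrier G \<Longrightarrow> x \<in> D g \<Longrightarrow> f x = f' x"
  shows "f = f'"
proof (rule endo_eqI[OF assms(1,2)])
  fix x assume x: "x \<in> carrier T"
  show "f x = f' x"
    unfolding endo_apply_eq_sum[OF assms(1) x] endo_apply_eq_sum[OF assms(2) x]
    using x assms by (intro T.finsum_cong') (simp_all add: T.proj_in_part T.proj_closed)
qed

lemma translate_sum: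
  assumes g: "g \<in> carrier G" and y: "y \<in> carrier G \<rightarrow> carrier T"
  shows "finsum T (\<lambda>h. y (g \<otimes>\<^bsub>G\<^esub> h)) (carrier G) = finsum T y (carrier G)"
  using T.finsum_reindex[of y "\<lambda>h. g \<otimes>\<^bsub>G\<^esub> h" "carrier G"] G.bij_betw_translate[OF g] y
  by (simp add: bij_betw_def)

text \<open>On \<open>x\<close> in \<open>D g\<close> the components of \<open>f\<close> give the
  parts of \<open>f x\<close> in the degrees \<open>g h\<close>. As \<open>h\<close> runs through
  the group so does \<open>g h\<close>, and these parts add up to \<open>f x\<close>.\<close>

lemma sum_endo_proj:
  assumes f: "f \<in> module_endos A T"
  shows "finsum E (\<lambda>h. endo_proj h f) (carrier G) = f"
proof (rule endo_eq_on_partsI)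
  interpret EG: abelian_group E by (rule endo_abelian_group)
  show "finsum E (\<lambda>h. endo_proj h f) (carrier G) \<in> module_endos A T"
    using EG.finsum_closed[of "\<lambda>h. endo_proj h f" "carrier G"] f by (simp add: endo_proj_closed)
  fix g x assume g: "g \<in> carrier G" and x: "x \<in> D g"
  have xc: "x \<in> carrier T" using T.part_subset g x .
  have "finsum E (\<lambda>h. endo_proj h f) (carrier G) x = finsum T (\<lambda>h. endo_proj h f x) (carrier G)"
    using f xc by (simp add: endo_finsum_apply finite_G endo_proj_closed)
  also have "\<dots> = finsum T (\<lambda>h. T.proj (g \<otimes>\<^bsub>G\<^esub> h) (f x)) (carrier G)"
    using f g x xc by (intro T.finsum_cong') (simp_all add: endo_proj_apply_part T.proj_closed)
  also have "\<dots> = finsum T (\<lambda>h. T.proj h (f x)) (carrier G)"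
    using f g xc by (intro translate_sum) (simp_all add: T.proj_closed)
  also have "\<dots> = f x" using f xc by (simp add: T.sum_proj)
  finally show "finsum E (\<lambda>h. endo_proj h f) (carrier G) x = f x" .
qed (rule f)

text \<open>For \<open>x\<close> in \<open>D g\<close> the values \<open>y k x\<close> lie in the
  pairwise different degrees \<open>g k\<close>, so they are the homogeneous components of the value
  of the sum at \<open>x\<close>, and a projection recovers each of them.\<close>

lemma endo_decomposition_unique:
  assumes y: "\<And>h. h \<in> carrier G \<Longrightarrow> y h \<in> endo_part h" and h: "h \<in> carrier G"
  shows "y h = endo_proj h (finsum E y (carrier G))"
proof (rule endo_eq_on_partsI)
  interpret EG: abelian_group E by (rule endo_abelian_group)
  let ?f = "finsum E y (carrier G)"
  have yE: "y k \<in> module_endos A T" if "k \<in> carrier G" for k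
    using y[OF that] endo_part_subset[OF that] by blast
  have f: "?f \<in> module_endos A T" using EG.finsum_closed[of y "carrier G"] yE by simp
  show "y h \<in> module_endos A T" "endo_proj h ?f \<in> module_endos A T"
    using yE h f by (simp_all add: endo_proj_closed)
  fix g x assume g: "g \<in> carrier G" and x: "x \<in> D g"
  have xc: "x \<in> carrier T" using T.part_subset g x .
  \<comment> \<open>The index is translated by the inverse of \<open>g\<close> so that the member at
    \<open>k\<close> lies in \<open>D k\<close>, the form that \<open>proj_finsum\<close>
    expects.\<close>
  let ?z = "\<lambda>k. y (inv\<^bsub>G\<^esub> g \<otimes>\<^bsub>G\<^esub> k) x"
  have z: "?z k \<in> D k" if k: "k \<in> carrier G" for k
  proof -
    have "y (inv\<^bsub>G\<^esub> g \<otimes>\<^bsub>G\<^esub> k) ` D g \<subseteq> D (g \<otimes>\<^bsub>G\<^esub> (inv\<^bsub>G\<^esub> g \<otimes>\<^bsub>G\<^esub> k))"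
      using y[of "inv\<^bsub>G\<^esub> g \<otimes>\<^bsub>G\<^esub> k"] g k by (simp add: endo_part_def)
    then show ?thesis using g k x by (auto simp: G.m_assoc[symmetric])
  qed
  have gz: "?z (g \<otimes>\<^bsub>G\<^esub> k) = y k x" if "k \<in> carrier G" for k
    using g that by (simp add: G.m_assoc[symmetric])
  have "?f x = finsum T (\<lambda>k. y k x) (carrier G)"
    using yE xc by (simp add: endo_finsum_apply finite_G)
  also have "\<dots> = finsum T (\<lambda>k. ?z (g \<otimes>\<^bsub>G\<^esub> k)) (carrier G)"
    using yE xc by (intro T.finsum_cong') (simp_all add: gz)
  also have "\<dots> = finsum T ?z (carrier G)"
    using g z T.part_subset by (intro translate_sum) auto
  finally have "endo_proj h ?f x = T.proj (g \<otimes>\<^bsub>G\<^esub> h) (finsum T ?z (carrier G))"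
    using endo_proj_apply_part[OF h f g x] by simp
  also have "\<dots> = ?z (g \<otimes>\<^bsub>G\<^esub> h)"
    using g h z by (intro T.proj_finsum) simp_all
  finally show "y h x = endo_proj h ?f x" using gz[OF h] by simp
qed

theorem endo_graded_algebra: "graded_algebra R G E endo_part"
proof (intro graded_algebra.intro graded_algebra_axioms.intro)
  interpret EG: abelian_group E by (rule endo_abelian_group)
  show "assoc_algebra R E" by (rule endo_algebra)
  show "Group.group G" by (rule G.group_axioms)
  show "finite (carrier G)" by (rule finite_G)
  fix f assume "f \<in> carrier E"
  then have f: "f \<in> module_endos A T" by simp
  show "\<exists>!y. y \<in> (\<Pi>\<^sub>E h\<in>carrier G. endo_part h) \<and> f = (\<Oplus>\<^bsub>E\<^esub>h\<in>carrier G. y h)"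
  proof (rule ex1I)
    have "f = (\<Oplus>\<^bsub>E\<^esub>h\<in>carrier G. (\<lambda>h\<in>carrier G. endo_proj h f) h)"
      using EG.finsum_cong'[of "carrier G" "carrier G" "\<lambda>h. endo_proj h f" "\<lambda>h\<in>carrier G. endo_proj h f"]
        sum_endo_proj[OF f] endo_proj_closed[OF _ f] by (simp del: restrict_apply add: restrict_apply')
    then show "(\<lambda>h\<in>carrier G. endo_proj h f) \<in> (\<Pi>\<^sub>E h\<in>carrier G. endo_part h) \<and>
        f = (\<Oplus>\<^bsub>E\<^esub>h\<in>carrier G. (\<lambda>h\<in>carrier G. endo_proj h f) h)"
      using f endo_proj_in_part by auto
  next
    fix y assume y: "y \<in> (\<Pi>\<^sub>E h\<in>carrier G. endo_part h) \<and> f = (\<Oplus>\<^bsub>E\<^esub>h\<in>carrier G. y h)"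
    then have "y h = endo_proj h f" if "h \<in> carrier G" for h
      using endo_decomposition_unique[of y h] that by auto
    then show "y = (\<lambda>h\<in>carrier G. endo_proj h f)"
      using y by (intro extensionalityI[of _ "carrier G"]) (auto simp: PiE_iff)
  qed
qed (rule endo_part_submodule endo_part_mult | assumption)+

end

section \<open>Functoriality of the induced module\<close>

text \<open>The endomorphism \<open>\<phi> \<otimes> id\<close> of the induced module. With \<open>\<phi>\<close> a left multiplication this is
  the action of \<open>A\<close>, with \<open>\<phi>\<close> the projection onto a component it is the projection for the
  grading, and with \<open>\<phi>\<close> right multiplication by an element of the centralizer it is \<open>\<theta>\<close>.\<close>
definition tensor_map ::
    "('o, 'a, 'n) module_scheme \<Rightarrow> 'a set \<Rightarrow> ('a, 'u, 'm) module_scheme \<Rightarrow> ('a \<Rightarrow> 'a) \<Rightarrow>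
     ('a \<times> 'u \<Rightarrow>\<^sub>0 int) set \<Rightarrow> ('a \<times> 'u \<Rightarrow>\<^sub>0 int) set" where
  "tensor_map A B U \<phi> Z =
     (\<Union>x\<in>Z. tensor_coset A B U (frag_extend (\<lambda>(a, u). frag_of (\<phi> a, u)) x))"

lemma subalg_sel [simp]:
  "carrier (subalg A S) = S"
  "x \<otimes>\<^bsub>subalg A S\<^esub> y = x \<otimes>\<^bsub>A\<^esub> y"
  "\<one>\<^bsub>subalg A S\<^esub> = \<one>\<^bsub>A\<^esub>"
  "x \<oplus>\<^bsub>subalg A S\<^esub> y = x \<oplus>\<^bsub>A\<^esub> y"
  "\<zero>\<^bsub>subalg A S\<^esub> = \<zero>\<^bsub>A\<^esub>"
  "r \<odot>\<^bsub>subalg A S\<^esub> x = r \<odot>\<^bsub>A\<^esub> x"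
  by (simp_all add: subalg_def)

section \<open>The induced module as a quotient of a free abelian group\<close>

locale tensor_product = A: ring A + U: left_module "subalg A B" U
  for A :: "('o, 'a, 'n) module_scheme" and B :: "'a set"
    and U :: "('a, 'u, 'm) module_scheme" +
  assumes B_subset: "B \<subseteq> carrier A"
begin

abbreviation F where "F \<equiv> tensor_free A U"
abbreviation N where "N \<equiv> tensor_null A B U"
abbreviation T where "T \<equiv> induced_module A B U"
abbreviation coset where "coset \<equiv> tensor_coset A B U"
abbreviation pure where "pure \<equiv> pure_tensor A B U"

definition right_linear :: "('a \<Rightarrow> 'a) set" where
  "right_linear = {\<phi> \<in> additive_hom A A. \<forall>a\<in>carrier A. \<forall>b\<in>B. \<phi> (a \<otimes>\<^bsub>A\<^esub> b) = \<phi> a \<otimes>\<^bsub>A\<^esub> b}"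

lemma right_linearI:
  assumes "\<phi> \<in> additive_hom A A"
    and "\<And>a b. a \<in> carrier A \<Longrightarrow> b \<in> B \<Longrightarrow> \<phi> (a \<otimes>\<^bsub>A\<^esub> b) = \<phi> a \<otimes>\<^bsub>A\<^esub> b"
  shows "\<phi> \<in> right_linear"
  using assms by (simp add: right_linear_def)

lemma right_linearD:
  assumes "\<phi> \<in> right_linear"
  shows "\<phi> \<in> additive_hom A A"
    and "a \<in> carrier A \<Longrightarrow> b \<in> B \<Longrightarrow> \<phi> (a \<otimes>\<^bsub>A\<^esub> b) = \<phi> a \<otimes>\<^bsub>A\<^esub> b"
  using assms by (simp_all add: right_linear_def)

lemma free_diff: "x \<in> carrier F \<Longrightarrow> y \<in> carrier F \<Longrightarrow> x - y \<in> carrier F"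
  and free_add: "x \<in> carrier F \<Longrightarrow> y \<in> carrier F \<Longrightarrow> x + y \<in> carrier F"
  using keys_diff[of x y] keys_add[of x y] by auto

lemma free_of: "a \<in> carrier A \<Longrightarrow> u \<in> carrier U \<Longrightarrow> frag_of (a, u) \<in> carrier F"
  by simp

lemma relatorI:
  "a \<in> carrier A \<Longrightarrow> a' \<in> carrier A \<Longrightarrow> u \<in> carrier U \<Longrightarrow>
    frag_of (a \<oplus>\<^bsub>A\<^esub> a', u) - frag_of (a, u) - frag_of (a', u) \<in> tensor_relators A B U"
  "a \<in> carrier A \<Longrightarrow> u \<in> carrier U \<Longrightarrow> u' \<in> carrier U \<Longrightarrow>
    frag_of (a, u \<oplus>\<^bsub>U\<^esub> u') - frag_of (a, u) - frag_of (a, u') \<in> tensor_relators A B U"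
  "a \<in> carrier A \<Longrightarrow> b \<in> B \<Longrightarrow> u \<in> carrier U \<Longrightarrow>
    frag_of (a \<otimes>\<^bsub>A\<^esub> b, u) - frag_of (a, b \<odot>\<^bsub>U\<^esub> u) \<in> tensor_relators A B U"
  unfolding tensor_relators_def by blast+

lemma relator_cases:
  assumes "x \<in> tensor_relators A B U"
  obtains
    (add_left) a a' u where "a \<in> carrier A" "a' \<in> carrier A" "u \<in> carrier U"
      "x = frag_of (a \<oplus>\<^bsub>A\<^esub> a', u) - frag_of (a, u) - frag_of (a', u)"
  | (add_right) a u u' where "a \<in> carrier A" "u \<in> carrier U" "u' \<in> carrier U"
      "x = frag_of (a, u \<oplus>\<^bsub>U\<^esub> u') - frag_of (a, u) - frag_of (a, u')"
  | (balanced) a b u where "a \<in> carrier A" "b \<in> B" "u \<in> carrier U"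
      "x = frag_of (a \<otimes>\<^bsub>A\<^esub> b, u) - frag_of (a, b \<odot>\<^bsub>U\<^esub> u)"
  using assms unfolding tensor_relators_def
  by (elim UnE CollectE exE conjE) (erule (3) that)+

lemma relators_subset: "tensor_relators A B U \<subseteq> carrier F"
proof
  fix x assume "x \<in> tensor_relators A B U"
  then show "x \<in> carrier F"
  proof (cases rule: relator_cases)
    case (balanced a b u)
    then have "a \<otimes>\<^bsub>A\<^esub> b \<in> carrier A" "b \<odot>\<^bsub>U\<^esub> u \<in> carrier U"
      using B_subset U.smult_closed by auto
    with balanced show ?thesis by (simp only: free_diff free_of)
  qed (simp_all only: free_diff free_of A.a_closed U.M.a_closed)
qed

lemma null_subgroup: "subgroup N F"
  unfolding tensor_null_def
  by (rule group.generate_is_subgroup[OF group_free_Abelian_group relators_subset])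

lemma null_normal: "N \<lhd> F"
  by (rule comm_group.subgroup_imp_normal[OF abelian_free_Abelian_group null_subgroup])

text \<open>The third equation matters most: the action of \<open>a\<close> is the map induced by
  left multiplication, so whatever holds for \<open>tensor_map\<close> applies to the module
  structure.\<close>

lemma induced_sel:
  "carrier T = coset ` carrier F"
  "\<zero>\<^bsub>T\<^esub> = N"
  "a \<odot>\<^bsub>T\<^esub> Z = tensor_map A B U (\<lambda>x. a \<otimes>\<^bsub>A\<^esub> x) Z"
  by (simp_all add: induced_module_def Let_def carrier_FactGroup tensor_coset_def[abs_def] tensor_map_def)

lemma induced_FactGroup:
  "carrier T = carrier (F Mod N)" "add T = monoid.mult (F Mod N)" "\<zero>\<^bsub>T\<^esub> = \<one>\<^bsub>F Mod N\<^esub>"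
  by (simp_all add: induced_module_def Let_def)

lemma induced_abelian_group: "abelian_group T"
proof -
  interpret Q: comm_group "F Mod N"
    by (rule comm_group.abelian_FactGroup[OF abelian_free_Abelian_group null_subgroup])
  show ?thesis
    by (rule abelian_groupI; unfold induced_FactGroup)
      (rule Q.m_closed Q.one_closed Q.m_assoc Q.m_comm Q.l_one Q.l_inv_ex | assumption)+
qed

sublocale T: abelian_group T
  by (rule induced_abelian_group)

lemma coset_closed: "x \<in> carrier F \<Longrightarrow> coset x \<in> carrier T"
  by (simp only: induced_sel image_eqI)

lemma coset_add:
  assumes "x \<in> carrier F" "y \<in> carrier F"
  shows "coset (x + y) = coset x \<oplus>\<^bsub>T\<^esub> coset y"
  using normal.rcos_sum[OF null_normal assms]
  by (simp add: tensor_coset_def induced_module_def Let_def)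

lemma mem_coset_iff: "z \<in> coset x \<longleftrightarrow> (\<exists>n\<in>N. z = n + x)"
  by (simp add: tensor_coset_def r_coset_def)

lemma coset_eqI:
  assumes "x \<in> carrier F" "y - x \<in> N"
  shows "coset y = coset x"
proof -
  have "y \<in> coset x"
    using assms(2) by (auto simp: mem_coset_iff intro!: bexI[of _ "y - x"])
  then show ?thesis
    using group.repr_independence[OF group_free_Abelian_group _ assms(1) null_subgroup]
    by (simp add: tensor_coset_def)
qed

lemma pure_closed: "a \<in> carrier A \<Longrightarrow> u \<in> carrier U \<Longrightarrow> pure a u \<in> carrier T"
  unfolding pure_tensor_def by (rule coset_closed) simp

lemma pure_add_left:
  assumes "a \<in> carrier A" "a' \<in> carrier A" "u \<in> carrier U"
  shows "pure (a \<oplus>\<^bsub>A\<^esub> a') u = pure a u \<oplus>\<^bsub>T\<^esub> pure a' u"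
proof -
  have "frag_of (a \<oplus>\<^bsub>A\<^esub> a', u) - frag_of (a, u) - frag_of (a', u) \<in> N"
    unfolding tensor_null_def using assms by (intro generate.incl relatorI)
  then have "coset (frag_of (a \<oplus>\<^bsub>A\<^esub> a', u)) = coset (frag_of (a, u) + frag_of (a', u))"
    using assms by (intro coset_eqI free_add free_of) (simp_all add: algebra_simps)
  then show ?thesis
    unfolding pure_tensor_def using assms by (simp add: coset_add)
qed

lemma pure_additive: "u \<in> carrier U \<Longrightarrow> (\<lambda>a. pure a u) \<in> additive_hom A T"
  by (intro additive_homI) (simp_all add: pure_closed pure_add_left)

definition pures :: "'a set \<Rightarrow> ('a \<times> 'u \<Rightarrow>\<^sub>0 int) set set" where
  "pures S = {pure a u | a u. a \<in> S \<and> u \<in> carrier U}"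

lemma pures_subset: "S \<subseteq> carrier A \<Longrightarrow> pures S \<subseteq> carrier T"
  unfolding pures_def using pure_closed by blast

text \<open>The free group is generated by its basis, and the cosets of the basis elements are the
  pure tensors. The induction over the free group closes under differences, not sums.\<close>

lemma induced_generated: "generate (add_monoid T) (pures (carrier A)) = carrier T"
proof
  let ?H = "generate (add_monoid T) (pures (carrier A))"
  have H: "subgroup ?H (add_monoid T)"
    using pures_subset by (intro T.add.generate_is_subgroup) simp_all
  show "?H \<subseteq> carrier T" using subgroup.subset[OF H] by simp
  have "coset x \<in> ?H" if x: "Poly_Mapping.keys x \<subseteq> carrier A \<times> carrier U" for x
    using x
  proof (rule free_Abelian_group_induct)
    have "coset 0 = N"
      using coset_eqI[of 0 0] group.coset_mult_one[OF group_free_Abelian_group subgroup.subset[OF null_subgroup]]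
      by (simp add: tensor_coset_def)
    then show "coset 0 \<in> ?H" using subgroup.one_closed[OF H] by (simp add: induced_sel(2))
  next
    fix x y
    assume 2: "Poly_Mapping.keys x \<subseteq> carrier A \<times> carrier U" "Poly_Mapping.keys y \<subseteq> carrier A \<times> carrier U"
      "coset x \<in> ?H" "coset y \<in> ?H"
    then have F: "x - y \<in> carrier F" "x \<in> carrier F" "y \<in> carrier F"
      by (simp_all add: free_diff del: carrier_free_Abelian_group_iff add: carrier_free_Abelian_group_iff[symmetric])
    \<comment> \<open>Only sums of cosets are known so far; the coset of the difference is obtained
      by solving this equation.\<close>
    have "coset x = coset (x - y) \<oplus>\<^bsub>T\<^esub> coset y" using coset_add[OF F(1,3)] by simp
    then have "coset (x - y) = coset x \<oplus>\<^bsub>T\<^esub> \<ominus>\<^bsub>T\<^esub> coset y"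
      using F[THEN coset_closed] by (simp add: T.a_assoc T.r_neg)
    moreover have "\<ominus>\<^bsub>T\<^esub> coset y \<in> ?H"
      using subgroup.m_inv_closed[OF H 2(4)] by (simp add: a_inv_def)
    ultimately show "coset (x - y) \<in> ?H" using subgroup.m_closed[OF H 2(3)] by simp
  next
    fix p assume "p \<in> carrier A \<times> carrier U"
    then show "coset (frag_of p) \<in> ?H"
      by (intro generate.incl) (auto simp: pures_def pure_tensor_def)
  qed
  then show "carrier T \<subseteq> ?H" by (auto simp: induced_sel(1))
qed

lemma induced_hom_eqI:
  assumes "abelian_group M" "f \<in> additive_hom T M" "f' \<in> additive_hom T M"
    and "\<And>a u. a \<in> carrier A \<Longrightarrow> u \<in> carrier U \<Longrightarrow> f (pure a u) = f' (pure a u)"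
    and "x \<in> carrier T"
  shows "f x = f' x"
proof (rule hom_eq_on_generate[OF T.a_group abelian_group.a_group[OF assms(1)] assms(2,3)])
  show "pures (carrier A) \<subseteq> carrier (add_monoid T)" using pures_subset by simp
  show "x \<in> generate (add_monoid T) (pures (carrier A))" using assms(5) induced_generated by simp
qed (use assms(4) in \<open>unfold pures_def, blast\<close>)

section \<open>Maps of the induced module coming from right linear maps of the algebra\<close>

abbreviation ext :: "('a \<Rightarrow> 'a) \<Rightarrow> ('a \<times> 'u \<Rightarrow>\<^sub>0 int) \<Rightarrow> ('a \<times> 'u \<Rightarrow>\<^sub>0 int)" where
  "ext \<phi> \<equiv> frag_extend (\<lambda>(a, u). frag_of (\<phi> a, u))"

lemma ext_hom:
  assumes "\<phi> \<in> carrier A \<rightarrow> carrier A"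
  shows "ext \<phi> \<in> hom F F"
proof -
  have "ext \<phi> x \<in> carrier F" if "x \<in> carrier F" for x
  proof -
    have "(\<Union>p\<in>Poly_Mapping.keys x. Poly_Mapping.keys (case p of (a, u) \<Rightarrow> frag_of (\<phi> a, u)))
        \<subseteq> carrier A \<times> carrier U"
      using that assms by (auto simp: subset_iff)
    then show ?thesis
      using keys_frag_extend[of "\<lambda>(a, u). frag_of (\<phi> a, u)" x] by simp
  qed
  then show ?thesis
    by (simp add: hom_def frag_extend_add del: carrier_free_Abelian_group_iff)
qed

text \<open>Each relator is sent to a relator of the same kind: additivity of \<phi> handles the
  relators for sums in the first factor, right linearity the balancing ones, and those for sums in
  the second factor are respected by any map of the first.\<close>

lemma ext_null:
  assumes \<phi>: "\<phi> \<in> right_linear" and n: "n \<in> N"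
  shows "ext \<phi> n \<in> N"
proof -
  note \<phi>D = additive_homD[OF right_linearD(1)[OF \<phi>]] right_linearD(2)[OF \<phi>]
  have "ext \<phi> x \<in> N" if "x \<in> tensor_relators A B U" for x
  proof -
    from that have "ext \<phi> x \<in> tensor_relators A B U"
    proof (cases rule: relator_cases)
      case (add_left a a' u)
      then show ?thesis
        using relatorI(1)[of "\<phi> a" "\<phi> a'" u] by (simp add: frag_extend_diff \<phi>D)
    next
      case (add_right a u u')
      then show ?thesis
        using relatorI(2)[of "\<phi> a" u u'] by (simp add: frag_extend_diff \<phi>D)
    next
      case (balanced a b u)
      then show ?thesis
        using relatorI(3)[of "\<phi> a" b u] by (simp add: frag_extend_diff \<phi>D)
    qed
    then show ?thesis unfolding tensor_null_def by (rule generate.incl)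
  qed
  moreover have "ext \<phi> \<in> hom F F" using \<phi>D(1) by (intro ext_hom) blast
  ultimately have "ext \<phi> ` N \<subseteq> N"
    using hom_generate_subset[OF group_free_Abelian_group group_free_Abelian_group _
        relators_subset null_subgroup] unfolding tensor_null_def by blast
  then show ?thesis using n by blast
qed

text \<open>Two representatives differ by a relation, and relations go to relations, so all members
  of the union coincide. The union is not empty since \<open>x\<close> lies in its own
  coset.\<close>

lemma tensor_map_coset:
  assumes \<phi>: "\<phi> \<in> right_linear" and x: "x \<in> carrier F"
  shows "tensor_map A B U \<phi> (coset x) = coset (ext \<phi> x)"
proof -
  have "ext \<phi> x \<in> carrier F"
    using additive_homD(1)[OF right_linearD(1)[OF \<phi>]] x
    by (intro hom_in_carrier[OF ext_hom]) blast+
  then have "coset (ext \<phi> z) = coset (ext \<phi> x)" if "z \<in> coset x" for z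
    using that ext_null[OF \<phi>] by (intro coset_eqI) (auto simp: mem_coset_iff frag_extend_add)
  moreover have "x \<in> coset x"
    using subgroup.one_closed[OF null_subgroup] by (force simp: mem_coset_iff)
  ultimately show ?thesis unfolding tensor_map_def by blast
qed

lemma tensor_map_pure:
  assumes "\<phi> \<in> right_linear" "a \<in> carrier A" "u \<in> carrier U"
  shows "tensor_map A B U \<phi> (pure a u) = pure (\<phi> a) u"
  unfolding pure_tensor_def using assms by (simp add: tensor_map_coset)

lemma tensor_map_additive:
  assumes \<phi>: "\<phi> \<in> right_linear"
  shows "tensor_map A B U \<phi> \<in> additive_hom T T"
proof (rule additive_homI)
  have ext: "ext \<phi> x \<in> carrier F" if "x \<in> carrier F" for x
    using additive_homD(1)[OF right_linearD(1)[OF \<phi>]] that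
    by (intro hom_in_carrier[OF ext_hom]) blast+
  fix V assume "V \<in> carrier T"
  then obtain x where x: "V = coset x" "x \<in> carrier F" unfolding induced_sel(1) by blast
  show "tensor_map A B U \<phi> V \<in> carrier T"
    unfolding x(1) tensor_map_coset[OF \<phi> x(2)] by (intro coset_closed ext x)
  fix W assume "W \<in> carrier T"
  then obtain y where y: "W = coset y" "y \<in> carrier F" unfolding induced_sel(1) by blast
  show "tensor_map A B U \<phi> (V \<oplus>\<^bsub>T\<^esub> W) = tensor_map A B U \<phi> V \<oplus>\<^bsub>T\<^esub> tensor_map A B U \<phi> W"
    unfolding x(1) y(1) coset_add[OF x(2) y(2), symmetric] tensor_map_coset[OF \<phi> x(2)]
      tensor_map_coset[OF \<phi> y(2)] tensor_map_coset[OF \<phi> free_add[OF x(2) y(2)]] frag_extend_add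
    by (intro coset_add ext x y)
qed

lemma left_mult_right_linear:
  assumes "a \<in> carrier A"
  shows "(\<lambda>x. a \<otimes>\<^bsub>A\<^esub> x) \<in> right_linear"
proof (intro right_linearI additive_homI)
  fix x b assume "x \<in> carrier A" "b \<in> B"
  then show "a \<otimes>\<^bsub>A\<^esub> (x \<otimes>\<^bsub>A\<^esub> b) = a \<otimes>\<^bsub>A\<^esub> x \<otimes>\<^bsub>A\<^esub> b"
    using assms B_subset by (intro A.m_assoc[symmetric]) auto
qed (simp_all add: assms A.r_distr)

lemma right_mult_right_linear:
  assumes "c \<in> centralizer A B"
  shows "(\<lambda>x. x \<otimes>\<^bsub>A\<^esub> c) \<in> right_linear"
proof (intro right_linearI additive_homI)
  have c: "c \<in> carrier A" using assms by (simp add: centralizer_def)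
  fix x b assume x: "x \<in> carrier A" and b: "b \<in> B"
  have "b \<in> carrier A" using b B_subset by auto
  moreover have "b \<otimes>\<^bsub>A\<^esub> c = c \<otimes>\<^bsub>A\<^esub> b" using assms b by (simp add: centralizer_def)
  ultimately show "x \<otimes>\<^bsub>A\<^esub> b \<otimes>\<^bsub>A\<^esub> c = x \<otimes>\<^bsub>A\<^esub> c \<otimes>\<^bsub>A\<^esub> b"
    using x c by (simp add: A.m_assoc)
qed (use assms in \<open>simp_all add: A.l_distr centralizer_def\<close>)

lemma smult_pure:
  assumes "a \<in> carrier A" "a' \<in> carrier A" "u \<in> carrier U"
  shows "a \<odot>\<^bsub>T\<^esub> pure a' u = pure (a \<otimes>\<^bsub>A\<^esub> a') u"
  unfolding induced_sel(3) using assms by (intro tensor_map_pure left_mult_right_linear)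

lemma induced_smult_additive: "a \<in> carrier A \<Longrightarrow> (\<lambda>x. a \<odot>\<^bsub>T\<^esub> x) \<in> additive_hom T T"
  unfolding induced_sel(3) by (intro tensor_map_additive left_mult_right_linear)

text \<open>With the scalars fixed, both sides of each equation between scalar expressions are
  additive in \<open>x\<close>. On pure tensors they reduce to distributivity, associativity and the
  unit law of \<open>A\<close> in the first factor.\<close>

lemma induced_left_module: "left_module A T"
proof (intro left_module.intro left_module_axioms.intro)
  note sm = induced_smult_additive
  note TT = induced_abelian_group
  fix a x assume a: "a \<in> carrier A" and x: "x \<in> carrier T"
  show "a \<odot>\<^bsub>T\<^esub> x \<in> carrier T" using additive_homD(1)[OF sm[OF a] x] .
  show "a \<odot>\<^bsub>T\<^esub> (x \<oplus>\<^bsub>T\<^esub> y) = a \<odot>\<^bsub>T\<^esub> x \<oplus>\<^bsub>T\<^esub> a \<odot>\<^bsub>T\<^esub> y" if "y \<in> carrier T" for y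
    using additive_homD(2)[OF sm[OF a] x that] .
  fix b assume b: "b \<in> carrier A"
  show "(a \<oplus>\<^bsub>A\<^esub> b) \<odot>\<^bsub>T\<^esub> x = a \<odot>\<^bsub>T\<^esub> x \<oplus>\<^bsub>T\<^esub> b \<odot>\<^bsub>T\<^esub> x"
  proof (rule induced_hom_eqI[OF TT sm _ _ x])
    show "(\<lambda>x. a \<odot>\<^bsub>T\<^esub> x \<oplus>\<^bsub>T\<^esub> b \<odot>\<^bsub>T\<^esub> x) \<in> additive_hom T T"
      using additive_homD[OF sm[OF a]] additive_homD[OF sm[OF b]]
      by (intro additive_homI) (simp_all add: T.a_ac)
  qed (simp_all add: a b smult_pure A.l_distr pure_add_left)
  show "(a \<otimes>\<^bsub>A\<^esub> b) \<odot>\<^bsub>T\<^esub> x = a \<odot>\<^bsub>T\<^esub> (b \<odot>\<^bsub>T\<^esub> x)"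
    by (rule induced_hom_eqI[OF TT sm additive_hom_comp[OF sm sm] _ x])
      (simp_all add: a b smult_pure A.m_assoc)
next
  fix x assume x: "x \<in> carrier T"
  have id: "(\<lambda>x. x) \<in> additive_hom T T" by (intro additive_homI) simp_all
  show "\<one>\<^bsub>A\<^esub> \<odot>\<^bsub>T\<^esub> x = x"
    by (rule induced_hom_eqI[OF induced_abelian_group induced_smult_additive id _ x])
      (simp_all add: smult_pure)
qed (rule A.ring_axioms induced_abelian_group)+

end

section \<open>The grading of the centralizer\<close>

context graded_algebra
begin

abbreviation C where "C \<equiv> centralizer A (gr \<one>\<^bsub>G\<^esub>)"

lemma identity_component_closed: "b \<in> gr \<one>\<^bsub>G\<^esub> \<Longrightarrow> b \<in> carrier A"
  using D.part_subset[of "\<one>\<^bsub>G\<^esub>" b] by simp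

lemma centralizerI:
  assumes "c \<in> carrier A" "\<And>b. b \<in> gr \<one>\<^bsub>G\<^esub> \<Longrightarrow> b \<otimes>\<^bsub>A\<^esub> c = c \<otimes>\<^bsub>A\<^esub> b"
  shows "c \<in> C"
  using assms by (simp add: centralizer_def)

lemma centralizerD:
  assumes "c \<in> C"
  shows "c \<in> carrier A" "b \<in> gr \<one>\<^bsub>G\<^esub> \<Longrightarrow> b \<otimes>\<^bsub>A\<^esub> c = c \<otimes>\<^bsub>A\<^esub> b"
  using assms by (simp_all add: centralizer_def)

lemma centralizer_subring: "subring C A"
proof (rule subringI)
  note cl = identity_component_closed
  show "C \<subseteq> carrier A" using centralizerD(1) by blast
  show "\<one>\<^bsub>A\<^esub> \<in> C" by (intro centralizerI) (simp_all add: cl)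
  fix c assume c: "c \<in> C"
  show "\<ominus>\<^bsub>A\<^esub> c \<in> C"
    using centralizerD[OF c] by (intro centralizerI) (simp_all add: cl l_minus r_minus)
  fix d assume d: "d \<in> C"
  show "c \<otimes>\<^bsub>A\<^esub> d \<in> C"
  proof (rule centralizerI)
    fix b assume b: "b \<in> gr \<one>\<^bsub>G\<^esub>"
    have "b \<otimes>\<^bsub>A\<^esub> (c \<otimes>\<^bsub>A\<^esub> d) = c \<otimes>\<^bsub>A\<^esub> b \<otimes>\<^bsub>A\<^esub> d"
      using centralizerD[OF c] centralizerD(1)[OF d] b by (simp add: cl flip: m_assoc)
    also have "\<dots> = c \<otimes>\<^bsub>A\<^esub> (d \<otimes>\<^bsub>A\<^esub> b)"
      using centralizerD(1)[OF c] centralizerD[OF d] b by (simp add: cl m_assoc)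
    also have "\<dots> = c \<otimes>\<^bsub>A\<^esub> d \<otimes>\<^bsub>A\<^esub> b"
      using centralizerD(1)[OF c] centralizerD(1)[OF d] b by (simp add: cl m_assoc)
    finally show "b \<otimes>\<^bsub>A\<^esub> (c \<otimes>\<^bsub>A\<^esub> d) = c \<otimes>\<^bsub>A\<^esub> d \<otimes>\<^bsub>A\<^esub> b" .
  qed (use centralizerD(1)[OF c] centralizerD(1)[OF d] in simp)
  show "c \<oplus>\<^bsub>A\<^esub> d \<in> C"
    using centralizerD[OF c] centralizerD[OF d]
    by (intro centralizerI) (simp_all add: cl l_distr r_distr)
qed

lemma centralizer_smult:
  assumes r: "r \<in> carrier R" and c: "c \<in> C"
  shows "r \<odot>\<^bsub>A\<^esub> c \<in> C"
  using centralizerD[OF c] r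
  by (intro centralizerI) (simp_all add: identity_component_closed smult_mult_left smult_mult_right)

lemma centralizer_submodule: "submodule C R A"
  by (intro submoduleI subringE(1,2,5,7)[OF centralizer_subring] centralizer_smult)

lemma centralizer_algebra: "assoc_algebra R (subalg A C)"
proof (intro assoc_algebra.intro assoc_algebra_axioms.intro)
  show "module R (subalg A C)"
    unfolding subalg_def by (rule submodule.submodule_is_module[OF centralizer_submodule module_axioms])
  show "ring (subalg A C)"
    unfolding subalg_def by (rule subring_is_ring[OF centralizer_subring])
qed (simp_all add: centralizerD(1) smult_mult_left smult_mult_right)

lemma centralizer_part_submodule:
  assumes h: "h \<in> carrier G"
  shows "submodule (C \<inter> gr h) R (subalg A C)"
proof (rule module.module_incl_imp_submodule)
  show "module R (subalg A C)" by (rule assoc_algebra.axioms(1)[OF centralizer_algebra])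
  note Ch = submoduleE(1,3,4,5)[OF centralizer_submodule] submoduleE(1,3,4,5)[OF comp_submodule[OF h]]
  \<comment> \<open>It is easier to work inside \<open>A\<close>, where both factors of the
    intersection are submodules. Restricting the carrier of \<open>A\<close> or of its subalgebra
    gives the same record, so the result transfers.\<close>
  have "submodule (C \<inter> gr h) R A"
  proof (rule submoduleI)
    show "\<zero>\<^bsub>A\<^esub> \<in> C \<inter> gr h"
      using subringE(2)[OF centralizer_subring] D.part_zero[OF h] by simp
  qed (auto intro: Ch(2-4,6-8) dest: subsetD[OF Ch(1)])
  then show "module R (subalg A C\<lparr>carrier := C \<inter> gr h\<rparr>)"
    using submodule.submodule_is_module[OF _ module_axioms] by (simp add: subalg_def)
qed simp

lemma proj_centralizer:
  assumes c: "c \<in> C" and h: "h \<in> carrier G"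
  shows "D.proj h c \<in> C"
proof (rule centralizerI)
  show "D.proj h c \<in> carrier A" using centralizerD(1)[OF c] h by (rule D.proj_closed)
  fix b assume b: "b \<in> gr \<one>\<^bsub>G\<^esub>"
  have "b \<otimes>\<^bsub>A\<^esub> D.proj h c = D.proj (\<one>\<^bsub>G\<^esub> \<otimes>\<^bsub>G\<^esub> h) (b \<otimes>\<^bsub>A\<^esub> c)"
    by (rule proj_left_mult[symmetric]) (simp_all add: h b centralizerD(1)[OF c])
  also have "\<dots> = D.proj h (c \<otimes>\<^bsub>A\<^esub> b)" using h centralizerD(2)[OF c b] by simp
  also have "\<dots> = D.proj h c \<otimes>\<^bsub>A\<^esub> b" by (rule proj_right_mult[OF h b centralizerD(1)[OF c]])
  finally show "b \<otimes>\<^bsub>A\<^esub> D.proj h c = D.proj h c \<otimes>\<^bsub>A\<^esub> b" .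
qed

text \<open>The two sums are formed in different records and do not agree by definition; they are
  compared through the inclusion, which is additive.\<close>

lemma finsum_centralizer:
  assumes "x \<in> I \<rightarrow> C" "finite I"
  shows "finsum (subalg A C) x I = finsum A x I"
proof -
  have "abelian_group (subalg A C)"
    using centralizer_algebra by (simp add: assoc_algebra_def module_def)
  moreover have "(\<lambda>x. x) \<in> additive_hom (subalg A C) A"
    by (intro additive_homI) (simp_all add: centralizerD(1))
  ultimately show ?thesis
    using additive_hom_finsum[of "subalg A C" A "\<lambda>x. x" I x] assms M.abelian_group_axioms by simp
qed

text \<open>Uniqueness of the decomposition is inherited from \<open>A\<close>; existence holds
  because the components taken in \<open>A\<close> stay in the centralizer.\<close>

theorem centralizer_graded_algebra: "graded_algebra R G (subalg A C) (\<lambda>h. C \<inter> gr h)"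
proof (intro graded_algebra.intro graded_algebra_axioms.intro)
  fix c assume "c \<in> carrier (subalg A C)"
  then have c: "c \<in> C" by simp
  have sum: "finsum (subalg A C) y (carrier G) = finsum A y (carrier G)"
    if "y \<in> (\<Pi>\<^sub>E h\<in>carrier G. C \<inter> gr h)" for y
    using that by (intro finsum_centralizer finite_G) auto
  show "\<exists>!y. y \<in> (\<Pi>\<^sub>E h\<in>carrier G. C \<inter> gr h) \<and> c = (\<Oplus>\<^bsub>subalg A C\<^esub>h\<in>carrier G. y h)"
  proof (rule ex1I)
    have y: "(\<lambda>h\<in>carrier G. D.proj h c) \<in> (\<Pi>\<^sub>E h\<in>carrier G. C \<inter> gr h)"
      using proj_centralizer[OF c] D.proj_in_part[OF centralizerD(1)[OF c]] by simp
    moreover have "finsum A (\<lambda>h\<in>carrier G. D.proj h c) (carrier G) = finsum A (\<lambda>h. D.proj h c) (carrier G)"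
      using centralizerD(1)[OF c] by (intro finsum_cong') (simp_all add: D.proj_closed)
    ultimately show "(\<lambda>h\<in>carrier G. D.proj h c) \<in> (\<Pi>\<^sub>E h\<in>carrier G. C \<inter> gr h) \<and>
        c = finsum (subalg A C) (\<lambda>h\<in>carrier G. D.proj h c) (carrier G)"
      using sum[OF y] D.sum_proj[OF centralizerD(1)[OF c]] by simp
  next
    fix y assume y: "y \<in> (\<Pi>\<^sub>E h\<in>carrier G. C \<inter> gr h) \<and> c = finsum (subalg A C) y (carrier G)"
    then have "c = finsum A y (carrier G)" using sum by simp
    moreover have "y h \<in> gr h" if "h \<in> carrier G" for h using y that by auto
    ultimately have "y h = D.proj h c" if "h \<in> carrier G" for h
      using D.proj_finsum[of y h] that by simp
    then show "y = (\<lambda>h\<in>carrier G. D.proj h c)"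
      using y by (intro extensionalityI[of _ "carrier G"]) (auto simp: PiE_iff)
  qed
next
  fix g h x y
  assume "g \<in> carrier G" "h \<in> carrier G" "x \<in> C \<inter> gr g" "y \<in> C \<inter> gr h"
  then show "x \<otimes>\<^bsub>subalg A C\<^esub> y \<in> C \<inter> gr (g \<otimes>\<^bsub>G\<^esub> h)"
    using subringE(6)[OF centralizer_subring] comp_mult by simp
qed (rule centralizer_algebra G.group_axioms finite_G centralizer_part_submodule | assumption)+

end

section \<open>The grading of the induced module and the homomorphism\<close>

locale graded_tensor_product = graded_algebra R G A gr + tensor_product A B U
  for R :: "('o, 'm) ring_scheme" and G :: "('g, 'q) monoid_scheme"
    and A :: "('o, 'a, 'n) module_scheme" and gr :: "'g \<Rightarrow> 'a set"
    and B :: "'a set" and U :: "('a, 'u, 'k) module_scheme" +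
  assumes identity_component: "B = gr \<one>\<^bsub>G\<^esub>"
begin

abbreviation part where "part g \<equiv> tensor_part A B U (gr g)"

lemma part_eq: "part g = generate (add_monoid T) (pures (gr g))"
  by (simp add: tensor_part_def pures_def)

lemma pures_gr_subset: "g \<in> carrier G \<Longrightarrow> pures (gr g) \<subseteq> carrier T"
  using D.part_subset by (intro pures_subset) blast

lemma part_subgroup: "g \<in> carrier G \<Longrightarrow> subgroup (part g) (add_monoid T)"
  unfolding part_eq using pures_gr_subset by (intro T.add.generate_is_subgroup) simp

lemma pure_in_part: "a \<in> gr g \<Longrightarrow> u \<in> carrier U \<Longrightarrow> pure a u \<in> part g"
  unfolding part_eq pures_def by (rule generate.incl) blast

lemma image_part_subset:
  assumes "f \<in> additive_hom T T" "g \<in> carrier G" "h \<in> carrier G"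
    and "\<And>a u. a \<in> gr g \<Longrightarrow> u \<in> carrier U \<Longrightarrow> f (pure a u) \<in> part h"
  shows "f ` part g \<subseteq> part h"
  unfolding part_eq[of g]
proof (rule hom_generate_subset[OF T.a_group T.a_group assms(1)])
  show "pures (gr g) \<subseteq> carrier (add_monoid T)" using pures_gr_subset[OF assms(2)] by simp
  show "subgroup (part h) (add_monoid T)" by (rule part_subgroup[OF assms(3)])
  show "f ` pures (gr g) \<subseteq> part h" using assms(4) unfolding pures_def by blast
qed

lemma proj_right_linear: "g \<in> carrier G \<Longrightarrow> D.proj g \<in> right_linear"
  by (intro right_linearI D.proj_additive) (simp_all add: proj_right_mult identity_component)

abbreviation tensor_proj where "tensor_proj g \<equiv> tensor_map A B U (D.proj g)"

lemma tensor_proj_additive: "g \<in> carrier G \<Longrightarrow> tensor_proj g \<in> additive_hom T T"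
  by (intro tensor_map_additive proj_right_linear)

lemma tensor_proj_pure:
  "g \<in> carrier G \<Longrightarrow> a \<in> carrier A \<Longrightarrow> u \<in> carrier U \<Longrightarrow> tensor_proj g (pure a u) = pure (D.proj g a) u"
  by (intro tensor_map_pure proj_right_linear)

text \<open>Each condition on the projections is inherited from \<open>A\<close>: their sum is the
  identity because pure tensors are additive in the first factor, and orthogonality is checked on
  the generators of a part. As the parts are images inside the induced module, no injectivity of the
  tensor product enters.\<close>

lemma induced_decomposition: "direct_sum_decomposition T (carrier G) part"
proof (rule direct_sum_decompositionI[where P = tensor_proj])
  note TT = induced_abelian_group
  show "tensor_proj g x \<in> part g" if g: "g \<in> carrier G" and x: "x \<in> carrier T" for g x
  proof -
    have "tensor_proj g ` generate (add_monoid T) (pures (carrier A)) \<subseteq> part g"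
    proof (rule hom_generate_subset[OF T.a_group T.a_group tensor_proj_additive[OF g]])
      show "pures (carrier A) \<subseteq> carrier (add_monoid T)" using pures_subset by simp
      show "tensor_proj g ` pures (carrier A) \<subseteq> part g"
      proof
        fix y assume "y \<in> tensor_proj g ` pures (carrier A)"
        then obtain a u where y: "y = tensor_proj g (pure a u)" "a \<in> carrier A" "u \<in> carrier U"
          unfolding pures_def by blast
        show "y \<in> part g"
          unfolding y(1) tensor_proj_pure[OF g y(2,3)]
          by (rule pure_in_part[OF D.proj_in_part[OF y(2) g] y(3)])
      qed
    qed (rule part_subgroup[OF g])
    then show ?thesis using x unfolding induced_generated by blast
  qed
  show "(\<Oplus>\<^bsub>T\<^esub>g\<in>carrier G. tensor_proj g x) = x" if x: "x \<in> carrier T" for x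
  proof (rule induced_hom_eqI[OF TT _ _ _ x])
    show "(\<lambda>x. \<Oplus>\<^bsub>T\<^esub>g\<in>carrier G. tensor_proj g x) \<in> additive_hom T T"
      by (intro additive_hom_sum TT tensor_proj_additive)
    show "(\<lambda>x. x) \<in> additive_hom T T" by (intro additive_homI) simp_all
    fix a u assume a: "a \<in> carrier A" and u: "u \<in> carrier U"
    have "(\<Oplus>\<^bsub>T\<^esub>g\<in>carrier G. tensor_proj g (pure a u)) = (\<Oplus>\<^bsub>T\<^esub>g\<in>carrier G. pure (D.proj g a) u)"
      using a u by (intro T.finsum_cong') (simp_all add: tensor_proj_pure pure_closed D.proj_closed)
    also have "\<dots> = pure (\<Oplus>\<^bsub>A\<^esub>g\<in>carrier G. D.proj g a) u"
      by (rule additive_hom_finsum[OF M.abelian_group_axioms TT pure_additive[OF u] finite_G, symmetric])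
        (simp add: a D.proj_closed)
    also have "\<dots> = pure a u" by (simp add: a D.sum_proj)
    finally show "(\<Oplus>\<^bsub>T\<^esub>g\<in>carrier G. tensor_proj g (pure a u)) = pure a u" .
  qed
  show "tensor_proj h x = (if h = g then x else \<zero>\<^bsub>T\<^esub>)"
    if g: "g \<in> carrier G" and h: "h \<in> carrier G" and x: "x \<in> part g" for g h x
  proof (rule hom_eq_on_generate[OF T.a_group T.a_group tensor_proj_additive[OF h]])
    show "(\<lambda>x. if h = g then x else \<zero>\<^bsub>T\<^esub>) \<in> additive_hom T T"
      by (intro additive_homI) simp_all
    show "pures (gr g) \<subseteq> carrier (add_monoid T)" using pures_gr_subset[OF g] by simp
    show "x \<in> generate (add_monoid T) (pures (gr g))" using x by (simp add: part_eq)
    fix s assume "s \<in> pures (gr g)"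
    then obtain a u where s: "s = pure a u" "a \<in> gr g" "u \<in> carrier U"
      unfolding pures_def by blast
    then have "tensor_proj h s = pure (if h = g then a else \<zero>\<^bsub>A\<^esub>) u"
      using D.part_subset[OF g s(2)] h by (simp add: tensor_proj_pure D.proj_part[OF g h s(2)])
    moreover have "pure \<zero>\<^bsub>A\<^esub> u = \<zero>\<^bsub>T\<^esub>"
      by (rule additive_hom_zero[OF M.abelian_group_axioms TT pure_additive[OF s(3)]])
    ultimately show "tensor_proj h s = (if h = g then s else \<zero>\<^bsub>T\<^esub>)" using s(1) by simp
  qed
qed (rule induced_abelian_group finite_G part_subgroup tensor_proj_additive | assumption)+

sublocale GM: graded_module R G A gr T part
proof (intro graded_module.intro algebra_module.intro graded_module_axioms.intro)
  show "graded_algebra R G A gr" by (rule graded_algebra_axioms)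
  show "assoc_algebra R A" by (rule assoc_algebra_axioms)
  show "left_module A T" by (rule induced_left_module)
  show "direct_sum_decomposition T (carrier G) part" by (rule induced_decomposition)
  fix g h a x
  assume g: "g \<in> carrier G" and h: "h \<in> carrier G" and a: "a \<in> gr g" and x: "x \<in> part h"
  have ac: "a \<in> carrier A" using D.part_subset g a .
  have "(\<lambda>x. a \<odot>\<^bsub>T\<^esub> x) ` part h \<subseteq> part (g \<otimes>\<^bsub>G\<^esub> h)"
  proof (rule image_part_subset[OF induced_smult_additive[OF ac] h])
    fix a' u assume a': "a' \<in> gr h" and u: "u \<in> carrier U"
    then show "a \<odot>\<^bsub>T\<^esub> pure a' u \<in> part (g \<otimes>\<^bsub>G\<^esub> h)"
      unfolding smult_pure[OF ac D.part_subset[OF h a'] u]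
      by (intro pure_in_part comp_mult g h a)
  qed (simp add: g h)
  then show "a \<odot>\<^bsub>T\<^esub> x \<in> part (g \<otimes>\<^bsub>G\<^esub> h)" using x by blast
qed

lemma E_comp_eq: "E_comp G A gr U = GM.endo_part"
  by (rule ext)
    (simp only: E_comp_def Let_def E_alg_def GM.endo_part_def GM.endo_sel(1) identity_component[symmetric])

lemma E_alg_graded_algebra: "graded_algebra R G (E_alg A B U) (E_comp G A gr U)"
  unfolding E_comp_eq E_alg_def by (rule GM.endo_graded_algebra)

lemma endo_eq_on_pureI:
  assumes "f \<in> module_endos A T" "f' \<in> module_endos A T"
    and "\<And>a u. a \<in> carrier A \<Longrightarrow> u \<in> carrier U \<Longrightarrow> f (pure a u) = f' (pure a u)"
  shows "f = f'"
  by (rule GM.endo_eqI[OF assms(1,2)])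
    (rule induced_hom_eqI[OF induced_abelian_group GM.endo_additive[OF assms(1)]
        GM.endo_additive[OF assms(2)] assms(3)])

text \<open>Left multiplication by \<open>a\<close> and right multiplication by \<open>c\<close>
  commute by associativity of \<open>A\<close>, first on pure tensors and hence everywhere.\<close>

lemma right_mult_endo:
  assumes c: "c \<in> centralizer A B"
  shows "(\<lambda>x\<in>carrier T. tensor_map A B U (\<lambda>a. a \<otimes>\<^bsub>A\<^esub> c) x) \<in> module_endos A T"
proof -
  note rl = right_mult_right_linear[OF c]
  note hom = tensor_map_additive[OF rl]
  have cA: "c \<in> carrier A" using c by (simp add: centralizer_def)
  have "tensor_map A B U (\<lambda>a. a \<otimes>\<^bsub>A\<^esub> c) (a \<odot>\<^bsub>T\<^esub> x) = a \<odot>\<^bsub>T\<^esub> tensor_map A B U (\<lambda>a. a \<otimes>\<^bsub>A\<^esub> c) x"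
    if a: "a \<in> carrier A" and x: "x \<in> carrier T" for a x
  proof (rule induced_hom_eqI[OF induced_abelian_group _ _ _ x])
    show "(\<lambda>x. tensor_map A B U (\<lambda>a. a \<otimes>\<^bsub>A\<^esub> c) (a \<odot>\<^bsub>T\<^esub> x)) \<in> additive_hom T T"
      by (rule additive_hom_comp[OF induced_smult_additive[OF a] hom])
    show "(\<lambda>x. a \<odot>\<^bsub>T\<^esub> tensor_map A B U (\<lambda>a. a \<otimes>\<^bsub>A\<^esub> c) x) \<in> additive_hom T T"
      by (rule additive_hom_comp[OF hom induced_smult_additive[OF a]])
  qed (simp add: a cA smult_pure tensor_map_pure[OF rl] m_assoc)
  then show ?thesis
    using additive_homD[OF hom] by (intro GM.endoI) simp_all
qed

text \<open>This is the well-definedness of \<theta>: right multiplication by \<open>c\<close>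
  induces a map satisfying the formula, and the formula determines an endomorphism because pure
  tensors generate the module.\<close>

lemma theta_ex1:
  assumes c: "c \<in> centralizer A B"
  shows "\<exists>!f. f \<in> carrier (E_alg A B U) \<and>
    (\<forall>a\<in>carrier A. \<forall>u\<in>carrier U. f (pure a u) = pure (a \<otimes>\<^bsub>A\<^esub> c) u)"
proof (rule ex1I)
  let ?f = "\<lambda>x\<in>carrier T. tensor_map A B U (\<lambda>a. a \<otimes>\<^bsub>A\<^esub> c) x"
  show f: "?f \<in> carrier (E_alg A B U) \<and>
      (\<forall>a\<in>carrier A. \<forall>u\<in>carrier U. ?f (pure a u) = pure (a \<otimes>\<^bsub>A\<^esub> c) u)"
    using right_mult_endo[OF c]
    by (simp add: E_alg_def pure_closed tensor_map_pure[OF right_mult_right_linear[OF c]])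
  fix f assume "f \<in> carrier (E_alg A B U) \<and>
      (\<forall>a\<in>carrier A. \<forall>u\<in>carrier U. f (pure a u) = pure (a \<otimes>\<^bsub>A\<^esub> c) u)"
  then show "f = ?f"
    using f by (intro endo_eq_on_pureI) (simp_all only: E_alg_def GM.endo_sel)
qed

text \<open>Only the values of \<theta> on the centralizer are constrained. Every identity is tested
  on pure tensors; multiplicativity becomes \<open>a (c d) = (a c) d\<close>, where \<open>c\<close>
  acts before \<open>d\<close>, in agreement with the opposite product.\<close>

lemma theta_graded_algebra_hom:
  assumes \<theta>: "\<And>c. c \<in> centralizer A B \<Longrightarrow> \<theta> c \<in> carrier (E_alg A B U)"
    and \<theta>_pure: "\<And>c a u. c \<in> centralizer A B \<Longrightarrow> a \<in> carrier A \<Longrightarrow> u \<in> carrier U \<Longrightarrow>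
      \<theta> c (pure a u) = pure (a \<otimes>\<^bsub>A\<^esub> c) u"
  shows "graded_algebra_hom R G (subalg A (centralizer A B)) (\<lambda>h. centralizer A B \<inter> gr h)
      (E_alg A B U) (E_comp G A gr U) \<theta>"
proof (intro graded_algebra_hom.intro graded_algebra_hom_axioms.intro)
  have C: "C = centralizer A B" by (simp only: identity_component)
  note sub = subringE[OF centralizer_subring, unfolded C]
  have \<theta>E: "\<theta> c \<in> module_endos A T" if "c \<in> centralizer A B" for c
    using \<theta>[OF that] by (simp add: E_alg_def)
  have cA: "c \<in> carrier A" if "c \<in> centralizer A B" for c
    using sub(1) that by blast
  show "graded_algebra R G (subalg A (centralizer A B)) (\<lambda>h. centralizer A B \<inter> gr h)"
    using centralizer_graded_algebra unfolding C .
  show "graded_algebra R G (E_alg A B U) (E_comp G A gr U)" by (rule E_alg_graded_algebra)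
  show "\<theta> \<in> ring_hom (subalg A (centralizer A B)) (E_alg A B U)"
    unfolding E_alg_def
  proof (rule ring_hom_memI; unfold subalg_sel GM.endo_sel)
    fix c d assume c: "c \<in> centralizer A B" and d: "d \<in> centralizer A B"
    show "\<theta> (c \<otimes>\<^bsub>A\<^esub> d) = compose (carrier T) (\<theta> d) (\<theta> c)"
      using sub(6)[OF c d] c d
      by (intro endo_eq_on_pureI \<theta>E GM.endo_comp_closed)
        (simp_all add: \<theta>_pure compose_eq pure_closed cA m_assoc)
    show "\<theta> (c \<oplus>\<^bsub>A\<^esub> d) = (\<lambda>x\<in>carrier T. \<theta> c x \<oplus>\<^bsub>T\<^esub> \<theta> d x)"
      using sub(7)[OF c d] c d
      by (intro endo_eq_on_pureI \<theta>E GM.endo_add_closed)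
        (simp_all add: \<theta>_pure pure_closed cA r_distr pure_add_left)
  next
    show "\<theta> \<one>\<^bsub>A\<^esub> = (\<lambda>x\<in>carrier T. x)"
      using sub(3)
      by (intro endo_eq_on_pureI \<theta>E GM.endo_id_closed) (simp_all add: \<theta>_pure pure_closed)
  qed (rule \<theta>E)
  fix r c assume r: "r \<in> carrier R" and "c \<in> carrier (subalg A (centralizer A B))"
  then have c: "c \<in> centralizer A B" by simp
  have rc: "r \<odot>\<^bsub>A\<^esub> c \<in> centralizer A B" using centralizer_smult[of r c] r c unfolding C .
  \<comment> \<open>On first factors this is \<open>a (r c) = (r \<odot> 1) (a c)\<close>, both
    sides being \<open>r (a c)\<close>.\<close>
  show "\<theta> (r \<odot>\<^bsub>subalg A (centralizer A B)\<^esub> c) = r \<odot>\<^bsub>E_alg A B U\<^esub> \<theta> c"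
    unfolding E_alg_def subalg_sel GM.endo_sel
    using rc r c
    by (intro endo_eq_on_pureI \<theta>E GM.endo_smult_closed)
      (simp_all add: \<theta>_pure pure_closed cA smult_pure GM.scalar_closed smult_mult_left smult_mult_right)
next
  fix h assume h: "h \<in> carrier G"
  show "\<theta> ` (centralizer A B \<inter> gr h) \<subseteq> E_comp G A gr U h"
  proof
    fix f assume "f \<in> \<theta> ` (centralizer A B \<inter> gr h)"
    then obtain c where c: "f = \<theta> c" "c \<in> centralizer A B" "c \<in> gr h" by blast
    have fE: "f \<in> module_endos A T" using \<theta>[OF c(2)] c(1) by (simp add: E_alg_def)
    \<comment> \<open>A part is generated by pure tensors with first factor \<open>a\<close> of
      degree \<open>g\<close>, and \<open>a c\<close> has degree \<open>g h\<close>.\<close>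
    have "f ` part g \<subseteq> part (g \<otimes>\<^bsub>G\<^esub> h)" if g: "g \<in> carrier G" for g
    proof (rule image_part_subset[OF GM.endo_additive[OF fE] g])
      fix a u assume a: "a \<in> gr g" and u: "u \<in> carrier U"
      show "f (pure a u) \<in> part (g \<otimes>\<^bsub>G\<^esub> h)"
        unfolding c(1) \<theta>_pure[OF c(2) D.part_subset[OF g a] u]
        by (intro pure_in_part comp_mult g h a u c)
    qed (simp add: g h)
    then show "f \<in> E_comp G A gr U h"
      using fE unfolding E_comp_eq GM.endo_part_def by blast
  qed
qed

end

text \<open>Instead of defining \<theta> by a choice, the statement quantifies over all functions
  that obey the formula. The first conjunct guarantees that such functions exist and agree on the
  centralizer, the second applies to each of them.\<close>

theorem lemma3p2:
  fixes p :: nat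
    and K :: "('k, 'm1) ring_scheme"
    and R :: "('o, 'm2) ring_scheme"
    and k :: "('l, 'm3) ring_scheme"
    and G :: "('g, 'm4) monoid_scheme"
    and A :: "('o, 'a, 'm5) module_scheme"
    and gr :: "'g \<Rightarrow> 'a set"
    and B :: "'a set"
    and U :: "('a, 'u, 'm6) module_scheme"
  assumes "p_modular_system p K R k"
    and "crossed_product R G A gr"
    and B: "B = gr \<one>\<^bsub>G\<^esub>"
    and "left_module (subalg A B) U"
  shows "(\<forall>c \<in> centralizer A B. \<exists>!f. f \<in> carrier (E_alg A B U) \<and>
            (\<forall>a \<in> carrier A. \<forall>u \<in> carrier U.
               f (pure_tensor A B U a u) = pure_tensor A B U (a \<otimes>\<^bsub>A\<^esub> c) u)) \<and>
         (\<forall>\<theta>. (\<forall>c \<in> centralizer A B. \<theta> c \<in> carrier (E_alg A B U) \<and>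
            (\<forall>a \<in> carrier A. \<forall>u \<in> carrier U.
               \<theta> c (pure_tensor A B U a u) = pure_tensor A B U (a \<otimes>\<^bsub>A\<^esub> c) u)) \<longrightarrow>
            graded_algebra_hom R G
              (subalg A (centralizer A B)) (\<lambda>h. centralizer A B \<inter> gr h)
              (E_alg A B U) (E_comp G A gr U) \<theta>)"
proof -
  interpret graded_algebra R G A gr
    by (rule crossed_product.axioms(1)[OF assms(2)])
  have "B \<subseteq> carrier A" unfolding B by (rule subsetI) (rule identity_component_closed)
  then interpret graded_tensor_product R G A gr B U
    using assms(4) B graded_algebra_axioms ring_axioms
    by (intro graded_tensor_product.intro tensor_product.intro
        tensor_product_axioms.intro graded_tensor_product_axioms.intro)
  show ?thesis
    by (intro conjI ballI allI impI theta_ex1 theta_graded_algebra_hom) simp_all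
qed

end
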